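(* Let $k\ge 2$ be an integer, let $G$ be a $k$-edge-connected graph, and let $H$ be a minimum $k$-edge-connected spanning subgraph of $G$. Suppose that one of the following conditions holds: (1) $k=2$ (and $G$ is an arbitrary $2$-edge-connected graph); (2) $k\ge 4$ is even and $G=K_{k+1}$; (3) $G=K_{k,n}$ with $n\ge k$, where either $k\ge 4$ is even or $k=3$. Then $mc_k(G)=e(G)-e(H)+\lfloor \frac{k}{2}\rfloor$.
   Context: All graphs are finite, simple and undirected; $e(G)$ denotes the number of edges of $G$. A $k$-edge-connected graph has at least two vertices, and every two distinct vertices are joined by at least $k$ edge-disjoint paths (equivalently, deleting fewer than $k$ edges leaves it connected). A minimum $k$-edge-connected spanning subgraph of $G$ is a $k$-edge-connected spanning subgraph of $G$ with the minimum number of edges. An edge-coloring assigns to each edge a color, where adjacent edges may receive the same color. A path is monochromatic if all its edges have the same color. For a $k$-edge-connected graph $G$, an $MC_k$-coloring of $G$ is an edge-coloring such that every two distinct vertices of $G$ are connected by at least $k$ pairwise edge-disjoint monochromatic paths (different paths may have different colors). The monochromatic $k$-edge-connection number $mc_k(G)$ is the maximum number of colors actually used by an $MC_k$-coloring of $G$. *)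

theory Defs
  imports Complex_Main
begin

type_synonym 'a ugraph = "'a set \<times> 'a set set"

abbreviation verts :: "'a ugraph \<Rightarrow> 'a set" where
  "verts G \<equiv> fst G"

abbreviation edges :: "'a ugraph \<Rightarrow> 'a set set" where
  "edges G \<equiv> snd G"

text \<open>Finite simple undirected graphs: an edge is a two-element set of vertices.\<close>

definition simple_graph :: "'a ugraph \<Rightarrow> bool" where
  "simple_graph G \<longleftrightarrow> finite (verts G) \<and> (\<forall>e\<in>edges G. e \<subseteq> verts G \<and> card e = 2)"

definition e_num :: "'a ugraph \<Rightarrow> nat" where
  "e_num G = card (edges G)"

definition complete_graph :: "nat \<Rightarrow> 'a ugraph \<Rightarrow> bool" where
  "complete_graph n G \<longleftrightarrow> finite (verts G) \<and> card (verts G) = n \<and>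
     edges G = {{u, v} | u v. u \<in> verts G \<and> v \<in> verts G \<and> u \<noteq> v}"

definition complete_bipartite_graph :: "nat \<Rightarrow> nat \<Rightarrow> 'a ugraph \<Rightarrow> bool" where
  "complete_bipartite_graph m n G \<longleftrightarrow>
     (\<exists>A B. finite A \<and> finite B \<and> A \<inter> B = {} \<and> card A = m \<and> card B = n \<and>
        verts G = A \<union> B \<and> edges G = {{a, b} | a b. a \<in> A \<and> b \<in> B})"

text \<open>A path is represented by the list of the vertices it visits, in order.\<close>

definition path_edges :: "'a list \<Rightarrow> 'a set set" where
  "path_edges p = {{p ! i, p ! Suc i} | i. Suc i < length p}"

definition is_path :: "'a ugraph \<Rightarrow> 'a \<Rightarrow> 'a \<Rightarrow> 'a list \<Rightarrow> bool" where
  "is_path G u v p \<longleftrightarrow> p \<noteq> [] \<and> hd p = u \<and> last p = v \<and> distinct p \<and>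
     set p \<subseteq> verts G \<and> path_edges p \<subseteq> edges G"

definition edge_disjoint :: "'a list set \<Rightarrow> bool" where
  "edge_disjoint P \<longleftrightarrow> pairwise (\<lambda>p q. disjnt (path_edges p) (path_edges q)) P"

definition k_edge_connected :: "nat \<Rightarrow> 'a ugraph \<Rightarrow> bool" where
  "k_edge_connected k G \<longleftrightarrow> simple_graph G \<and> card (verts G) \<ge> 2 \<and>
     (\<forall>u\<in>verts G. \<forall>v\<in>verts G. u \<noteq> v \<longrightarrow>
        (\<exists>P. finite P \<and> card P \<ge> k \<and> edge_disjoint P \<and> (\<forall>p\<in>P. is_path G u v p)))"

definition spanning_subgraph :: "'a ugraph \<Rightarrow> 'a ugraph \<Rightarrow> bool" where
  "spanning_subgraph H G \<longleftrightarrow> simple_graph H \<and> verts H = verts G \<and> edges H \<subseteq> edges G"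

definition minimum_k_edge_connected_spanning_subgraph ::
    "nat \<Rightarrow> 'a ugraph \<Rightarrow> 'a ugraph \<Rightarrow> bool" where
  "minimum_k_edge_connected_spanning_subgraph k H G \<longleftrightarrow>
     spanning_subgraph H G \<and> k_edge_connected k H \<and>
     (\<forall>H'. spanning_subgraph H' G \<and> k_edge_connected k H' \<longrightarrow> e_num H \<le> e_num H')"

text \<open>An edge-coloring is a function on two-element sets, only its values on \<^term>\<open>edges G\<close>
  matter. Adjacent edges may share a color. Colors are natural numbers, which loses nothing
  as graphs are finite.\<close>

definition monochromatic :: "('a set \<Rightarrow> nat) \<Rightarrow> 'a list \<Rightarrow> bool" where
  "monochromatic c p \<longleftrightarrow> (\<exists>a. \<forall>e\<in>path_edges p. c e = a)"

definition MC_coloring :: "nat \<Rightarrow> 'a ugraph \<Rightarrow> ('a set \<Rightarrow> nat) \<Rightarrow> bool" where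
  "MC_coloring k G c \<longleftrightarrow>
     (\<forall>u\<in>verts G. \<forall>v\<in>verts G. u \<noteq> v \<longrightarrow>
        (\<exists>P. finite P \<and> card P \<ge> k \<and> edge_disjoint P \<and>
             (\<forall>p\<in>P. is_path G u v p \<and> monochromatic c p)))"

text \<open>For a \<^term>\<open>k\<close>-edge-connected graph the set below is nonempty (color all edges alike) and
  bounded by the number of edges, so the maximum exists.\<close>

definition mc :: "nat \<Rightarrow> 'a ugraph \<Rightarrow> nat" where
  "mc k G = Max {card (c ` edges G) | c. MC_coloring k G c}"

end

theory Submission
  imports Defs
begin

text \<open>In cases (2) and (3) all edges of \<open>G\<close> meet vertices of degree \<open>k\<close>, hence \<open>H = G\<close>, and every colour has
  the same degree, at least 2, at all these vertices; Hamiltonian decompositions attain \<open>\<lfloor>k/2\<rfloor>\<close> colours.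

  For \<open>k = 2\<close>, colour \<open>H\<close> with one colour and all other edges differently. Conversely, assume that all colour
  classes are connected (split them otherwise) and have \<open>e\<^sub>1, \<dots>, e\<^sub>t\<close> edges. A 2-edge-connected spanning subgraph
  with at most \<open>1 + \<Sum> (e\<^sub>i - 1)\<close> edges is grown from a 2-edge-connected part of one class, or, if all classes
  are trees, from the cycle that a longest path forms with the neighbours of its endpoint. Take an affordable
  vertex set \<open>B\<close> of maximal size. Maximality implies that the vertices outside \<open>B\<close> lie in so many classes
  meeting \<open>B\<close> that the remaining budget is at least two edges per missing vertex, and this is what adding ears costs.\<close>

section \<open>Reachability and 2-edge-connectedness\<close>

text \<open>The bound \<open>1 + \<Sum> (e\<^sub>i - 1)\<close> equals e(G) - t + 1, so minimality
  of \<open>H\<close> turns such a subgraph into t \<le> e(G) - e(H) + 1. The obstacle is that two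
  vertices may be joined by paths of two different colours, so that no class has to span
  \<open>V\<close> or be 2-edge-connected. The constants come from trees: a tree class with e edges
  has e + 1 vertices, hence its share e - 1 pays for all of them but two. An ear with r new vertices
  has r + 1 edges, at most 2r, so a missing vertex is paid for by two classes, provided that these
  two free vertices of each class have already been used up inside \<open>B\<close>. This fails for
  a tree meeting \<open>B\<close> in a single vertex, and two classes may be lacking if one class
  contains all of \<open>B\<close>; these two situations account for most of the counting. For
  degree k, the vertices considered in K_{k,n} are those of the side with n elements. For k = 3 the
  bound is 1, and a constant colouring attains it without any Hamiltonian decomposition.\<close>

definition reach :: "'a set set \<Rightarrow> ('a \<times> 'a) set" where
  "reach E = {(x, y). {x, y} \<in> E}\<^sup>*"

lemma reach_refl [simp, intro]: "(x, x) \<in> reach E"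
  by (simp add: reach_def)

lemma reach_edge: "{x, y} \<in> E \<Longrightarrow> (x, y) \<in> reach E"
  by (auto simp: reach_def)

lemma reach_trans: "(x, y) \<in> reach E \<Longrightarrow> (y, z) \<in> reach E \<Longrightarrow> (x, z) \<in> reach E"
  unfolding reach_def by (rule rtrancl_trans)

lemma reach_sym: "(x, y) \<in> reach E \<Longrightarrow> (y, x) \<in> reach E"
proof -
  have "sym {(x, y). {x, y} \<in> E}" by (auto simp: sym_def insert_commute)
  then have "sym (reach E)" unfolding reach_def by (rule sym_rtrancl)
  then show "(x, y) \<in> reach E \<Longrightarrow> (y, x) \<in> reach E" by (auto dest: symD)
qed

lemma reach_induct [consumes 1, case_names refl step]:
  assumes "(u, v) \<in> reach E" "P u"
    and "\<And>x y. (u, x) \<in> reach E \<Longrightarrow> {x, y} \<in> E \<Longrightarrow> P x \<Longrightarrow> P y"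
  shows "P v"
  using assms(1) unfolding reach_def
proof (induction rule: rtrancl_induct)
  case base then show ?case using assms(2) .
next
  case (step y z) then show ?case using assms(3)[of y z] by (auto simp: reach_def)
qed

lemma reach_subst:
  assumes "\<And>x y. {x, y} \<in> F \<Longrightarrow> (x, y) \<in> reach F'" and "(u, v) \<in> reach F"
  shows "(u, v) \<in> reach F'"
  using assms(2) by (induction rule: reach_induct) (auto intro: reach_trans assms(1))

lemma reach_mono: "(u, v) \<in> reach F \<Longrightarrow> F \<subseteq> F' \<Longrightarrow> (u, v) \<in> reach F'"
  by (rule reach_subst[of F F']) (auto intro: reach_edge)

lemma reach_seq:
  assumes "i \<le> j" "\<And>t. i \<le> t \<Longrightarrow> t < j \<Longrightarrow> {s t, s (Suc t)} \<in> F"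
  shows "(s i, s j) \<in> reach F"
  using assms by (induction j rule: dec_induct) (auto intro: reach_trans reach_edge)

lemma reach_cross:
  assumes "(u, v) \<in> reach F" "u \<in> U" "v \<notin> U"
  shows "\<exists>x\<in>U. \<exists>y. y \<notin> U \<and> {x, y} \<in> F"
proof (rule ccontr)
  assume *: "\<not> ?thesis"
  have "v \<in> U" using assms(1,2) by (induction rule: reach_induct) (use * in auto)
  then show False using assms by simp
qed

lemma reach_Union:
  assumes "(u, v) \<in> reach F" "u \<noteq> v"
  shows "v \<in> \<Union>F" "u \<in> \<Union>F"
proof -
  have "v = u \<or> v \<in> \<Union>F" if "(u, v) \<in> reach F" for u v
    using that by (induction rule: reach_induct) auto
  then show "v \<in> \<Union>F" "u \<in> \<Union>F" using assms reach_sym[OF assms(1)] by auto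
qed

section \<open>Paths as vertex lists\<close>

lemma path_edges_simps [simp]:
  "path_edges [] = {}" "path_edges [x] = {}"
  "path_edges (x # y # l) = insert {x, y} (path_edges (y # l))"
proof -
  show "path_edges (x # y # l) = insert {x, y} (path_edges (y # l))" (is "?A = ?B")
  proof (rule set_eqI)
    fix e
    have "e \<in> ?A \<longleftrightarrow> (\<exists>i < Suc (length l). e = {(x # y # l) ! i, (y # l) ! i})"
      by (auto simp: path_edges_def)
    also have "\<dots> \<longleftrightarrow> e \<in> ?B"
      by (simp only: Ex_less_Suc2) (auto simp: path_edges_def)
    finally show "e \<in> ?A \<longleftrightarrow> e \<in> ?B" .
  qed
qed (auto simp: path_edges_def)

lemma path_edges_append:
  "xs \<noteq> [] \<Longrightarrow> ys \<noteq> [] \<Longrightarrow> path_edges (xs @ ys) = path_edges xs \<union> path_edges ys \<union> {{last xs, hd ys}}"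
proof (induction xs rule: induct_list012)
  case (2 x) then show ?case by (cases ys) auto
qed auto

lemma path_edges_subset: "\<Union>(path_edges p) \<subseteq> set p"
  by (induction p rule: induct_list012) auto

lemma path_edges_nth: "Suc i < length p \<Longrightarrow> {p ! i, p ! Suc i} \<in> path_edges p"
  by (auto simp: path_edges_def)

lemma reach_path_edges:
  assumes "p \<noteq> []" "path_edges p \<subseteq> F"
  shows "(hd p, last p) \<in> reach F"
proof -
  have "(p ! 0, p ! (length p - 1)) \<in> reach F"
    
  proof (rule reach_seq[where s = "(!) p"])
    fix t assume "t < length p - 1"
    then have "{p ! t, p ! Suc t} \<in> path_edges p" by (intro path_edges_nth) simp
    then show "{p ! t, p ! Suc t} \<in> F" using assms by blast
  qed simp
  then show ?thesis using assms by (simp add: hd_conv_nth last_conv_nth)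
qed

lemma reach_obtain_path:
  assumes "(u, v) \<in> reach F"
  obtains p where "p \<noteq> []" "hd p = u" "last p = v" "distinct p" "path_edges p \<subseteq> F"
proof -
  have "\<exists>p. p \<noteq> [] \<and> hd p = u \<and> last p = v \<and> distinct p \<and> path_edges p \<subseteq> F"
    using assms
  proof (induction rule: reach_induct)
    case refl then show ?case by (intro exI[of _ "[u]"]) auto
  next
    case (step x y)
    then obtain p where p: "p \<noteq> []" "hd p = u" "last p = x" "distinct p" "path_edges p \<subseteq> F" by blast
    show ?case
    proof (cases "y \<in> set p")
      case True
      then obtain a b where ab: "p = a @ y # b" by (auto simp: in_set_conv_decomp)
      have "path_edges (a @ [y]) \<subseteq> path_edges p"
        unfolding ab using path_edges_append[of "a @ [y]" b] by (cases b) auto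
      then show ?thesis using p ab by (intro exI[of _ "a @ [y]"]) (cases a; auto)
    next
      case False
      then show ?thesis using p step by (intro exI[of _ "p @ [y]"]) (auto simp: path_edges_append)
    qed
  qed
  then show ?thesis using that by blast
qed

lemma is_path_reach: "is_path G u v p \<Longrightarrow> path_edges p \<subseteq> F \<Longrightarrow> (u, v) \<in> reach F"
  using reach_path_edges by (fastforce simp: is_path_def)

lemma path_edges_nonempty:
  assumes "p \<noteq> []" "hd p \<noteq> last p"
  shows "path_edges p \<noteq> {}"
proof -
  have "Suc 0 < length p" using assms by (cases p; cases "tl p") auto
  then show ?thesis using path_edges_nth[of 0 p] by auto
qed

text \<open>The deleted \<open>e\<close> may be any set, also a non-edge, so plain connectedness is
  included. Singletons satisfy it, which lets an ear argument start from one vertex.\<close>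

definition conn2 :: "'a set \<Rightarrow> 'a set set \<Rightarrow> bool" where
  "conn2 V E \<longleftrightarrow> (\<forall>e. \<forall>u\<in>V. \<forall>v\<in>V. (u, v) \<in> reach (E - {e}))"

lemma conn2_singleton [simp]: "conn2 {x} E"
  by (simp add: conn2_def)

text \<open>All later gluings use this form: after a deletion \<open>D\<close> still links the
  points of \<open>B\<close>, so new vertices only have to reach some point of
  \<open>B\<close>.\<close>

lemma conn2_extend:
  assumes "conn2 B D" "D \<subseteq> D'"
    and "\<And>v e. v \<in> B' \<Longrightarrow> v \<notin> B \<Longrightarrow> \<exists>b\<in>B. (v, b) \<in> reach (D' - {e})"
  shows "conn2 B' D'"
  unfolding conn2_def
proof (intro allI ballI)
  fix e u v assume uv: "u \<in> B'" "v \<in> B'"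
  have *: "\<exists>b\<in>B. (v, b) \<in> reach (D' - {e})" if "v \<in> B'" for v
    using assms(3) that by (cases "v \<in> B") auto
  obtain b b' where "b \<in> B" "(u, b) \<in> reach (D' - {e})" "b' \<in> B" "(v, b') \<in> reach (D' - {e})"
    using *[of u] *[of v] uv by blast
  moreover have "(b, b') \<in> reach (D' - {e})"
    using assms(1,2) calculation reach_mono[of b b' "D - {e}" "D' - {e}"] by (auto simp: conn2_def)
  ultimately show "(u, v) \<in> reach (D' - {e})" by (meson reach_trans reach_sym)
qed

text \<open>A deleted edge occurs at most once along the ear, so one of the two directions towards
  \<open>B\<close> stays intact. The ends may coincide, which makes a cycle an ear on a single
  vertex.\<close>

lemma conn2_ear:
  assumes "conn2 B D" "D \<subseteq> D'" "s 0 \<in> B" "s N \<in> B"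
    and inj: "inj_on (\<lambda>t. {s t, s (Suc t)}) {..<N}"
    and D': "\<And>t. t < N \<Longrightarrow> {s t, s (Suc t)} \<in> D'"
  shows "conn2 (B \<union> s ` {..N}) D'"
proof (rule conn2_extend[OF assms(1,2)])
  fix v e assume "v \<in> B \<union> s ` {..N}" "v \<notin> B"
  then obtain t where t: "t \<le> N" "v = s t" by auto
  show "\<exists>b\<in>B. (v, b) \<in> reach (D' - {e})"
  proof (cases "\<exists>i<t. e = {s i, s (Suc i)}")
    case True
    then obtain i where i: "i < t" "e = {s i, s (Suc i)}" by auto
    have "(s t, s N) \<in> reach (D' - {e})"
    proof (rule reach_seq[where s = s])
      fix j assume j: "t \<le> j" "j < N"
      then have "{s j, s (Suc j)} \<noteq> {s i, s (Suc i)}"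
        using inj_onD[OF inj, of j i] i(1) t(1) by force
      then show "{s j, s (Suc j)} \<in> D' - {e}" using D'[OF j(2)] i(2) by simp
    qed (use t in auto)
    then show ?thesis unfolding t(2) using assms(4) by blast
  next
    case False
    have "(s 0, s t) \<in> reach (D' - {e})"
      by (rule reach_seq[where s = s]) (use t(1) False D' in auto)
    then show ?thesis unfolding t(2) using assms(3) by (blast intro: reach_sym)
  qed
qed

lemma inj_on_edges:
  assumes "inj_on s {..N::nat}"
  shows "inj_on (\<lambda>t. {s t, s (Suc t)}) {..<N}"
proof (rule inj_onI)
  fix t t' assume *: "t \<in> {..<N}" "t' \<in> {..<N}" "{s t, s (Suc t)} = {s t', s (Suc t')}"
  then consider "s t = s t'" | "s t = s (Suc t')" "s (Suc t) = s t'" by (auto simp: doubleton_eq_iff)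
  then show "t = t'"
  proof cases
    case 1 then show ?thesis using inj_onD[OF assms, of t t'] * by simp
  next
    case 2
    then have "t = Suc t'" "Suc t = t'"
      using inj_onD[OF assms, of t "Suc t'"] inj_onD[OF assms, of "Suc t" t'] * by simp_all
    then show ?thesis by simp
  qed
qed

lemma conn2_cycle:
  assumes "inj_on s {..<N}" "s N = s 0" "3 \<le> N" and "\<And>t. t < N \<Longrightarrow> {s t, s (Suc t)} \<in> D"
  shows "conn2 (s ` {..<N}) D"
proof -
  have inj: "inj_on (\<lambda>t. {s t, s (Suc t)}) {..<N}"
  proof (rule inj_onI)
    fix t t' assume *: "t \<in> {..<N}" "t' \<in> {..<N}" "{s t, s (Suc t)} = {s t', s (Suc t')}"
    \<comment> \<open>The cyclic successor as an index below \<open>N\<close>, where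
      \<open>s\<close> is injective. Two edges traversed in opposite directions would give
      \<open>t = S t'\<close> and \<open>S t = t'\<close>, possible only for a cycle of length
      2.\<close>
    define S where "S = (\<lambda>t. if Suc t = N then 0 else Suc t)"
    have S: "s (Suc t) = s (S t)" "S t < N" if "t < N" for t using that assms(2,3) by (auto simp: S_def)
    consider "s t = s t'" | "s t = s (S t')" "s (S t) = s t'"
      using * S(1)[of t] S(1)[of t'] by (auto simp: doubleton_eq_iff)
    then show "t = t'"
    proof cases
      case 1 then show ?thesis using inj_onD[OF assms(1), of t t'] * by simp
    next
      case 2
      then have "t = S t'" "S t = t'"
        using inj_onD[OF assms(1), of t "S t'"] inj_onD[OF assms(1), of "S t" t'] * S(2) by simp_all
      then show ?thesis using assms(3) by (auto simp: S_def split: if_splits)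
    qed
  qed
  have "conn2 ({s 0} \<union> s ` {..N}) D"
    by (rule conn2_ear[where D = "{}", OF _ _ _ _ inj]) (use assms in auto)
  moreover have "{s 0} \<union> s ` {..N} = s ` {..<N}"
  proof -
    have "{..N} = insert N {..<N}" by auto
    then show ?thesis using assms(2,3) by (simp add: insert_absorb)
  qed
  ultimately show ?thesis by simp
qed

text \<open>An edge \<open>aw\<close> leaving \<open>B\<close> can be deleted without separating
  \<open>w\<close> from \<open>a\<close>. The first return to \<open>B\<close> of a path avoiding
  \<open>aw\<close> closes the ear; as \<open>w\<close> is new, the ear has at least two
  edges.\<close>

lemma conn2_ear_exists:
  fixes V :: "'a set"
  assumes "conn2 V E" "\<Union>E \<subseteq> V" "B \<subseteq> V" "B \<noteq> {}" "B \<noteq> V"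
  obtains s :: "nat \<Rightarrow> 'a" and N where "2 \<le> N" "s 0 \<in> B" "s N \<in> B"
    "\<And>t. 0 < t \<Longrightarrow> t < N \<Longrightarrow> s t \<notin> B" "inj_on s {0<..<N}"
    "inj_on (\<lambda>t. {s t, s (Suc t)}) {..<N}" "\<And>t. t < N \<Longrightarrow> {s t, s (Suc t)} \<in> E"
proof -
  obtain x y where xy: "x \<in> B" "y \<in> V" "y \<notin> B" using assms by auto
  then have "(x, y) \<in> reach E"
    using assms(1,3) reach_mono[of x y "E - {{}}" E] by (auto simp: conn2_def)
  then obtain a w where aw: "a \<in> B" "w \<notin> B" "{a, w} \<in> E"
    using reach_cross xy by meson
  define F where "F = E - {{a, w}}"
  have "(w, a) \<in> reach F" using aw assms(1,2,3) by (simp add: conn2_def F_def subset_iff) blast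
  then obtain p where p: "p \<noteq> []" "hd p = w" "last p = a" "distinct p" "path_edges p \<subseteq> F"
    by (rule reach_obtain_path)
  define n where "n = (LEAST n. p ! n \<in> B)"
  have last: "p ! (length p - 1) \<in> B" using p aw by (simp add: last_conv_nth)
  then have n: "p ! n \<in> B" "n \<le> length p - 1"
    unfolding n_def by (rule LeastI, rule Least_le)
  have n': "n < length p" using n p(1) by (cases p) auto
  have nB: "p ! t \<notin> B" if "t < n" for t using that not_less_Least unfolding n_def by blast
  have "p ! 0 = w" using p by (simp add: hd_conv_nth)
  then have "n > 0" using n aw by (cases n) auto
  have inj: "inj_on ((!) p) {..n}"
    using p(4) n' by (auto simp: inj_on_def nth_eq_iff_index_eq)
  define s where "s t = (case t of 0 \<Rightarrow> a | Suc i \<Rightarrow> p ! i)" for t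
  have sF: "{s t, s (Suc t)} \<in> F" if "0 < t" "t < Suc n" for t
    using that p(5) n path_edges_nth[of "t - 1" p] by (auto simp: s_def split: nat.splits)
  have s0: "{s 0, s (Suc 0)} = {a, w}" using \<open>p ! 0 = w\<close> by (simp add: s_def)
  show ?thesis
  proof (rule that[of "Suc n" s])
    show "inj_on s {0<..<Suc n}"
    proof (rule inj_onI)
      fix t t' assume "t \<in> {0<..<Suc n}" "t' \<in> {0<..<Suc n}" "s t = s t'"
      then show "t = t'" using inj_onD[OF inj, of "t - 1" "t' - 1"] by (auto simp: s_def split: nat.splits)
    qed
    show "inj_on (\<lambda>t. {s t, s (Suc t)}) {..<Suc n}"
    proof (rule inj_onI)
      fix t t' assume *: "t \<in> {..<Suc n}" "t' \<in> {..<Suc n}" "{s t, s (Suc t)} = {s t', s (Suc t')}"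
      have "t = 0 \<longleftrightarrow> t' = 0"
        using * sF[of t] sF[of t'] s0 by (auto simp: F_def)
      then show "t = t'"
        using inj_onD[OF inj_on_edges[OF inj], of "t - 1" "t' - 1"] *
        by (cases t; cases t') (auto simp: s_def)
    qed
    show "{s t, s (Suc t)} \<in> E" if "t < Suc n" for t
      using that sF[of t] s0 aw by (cases t) (auto simp: F_def)
  qed (use n nB \<open>n > 0\<close> aw in \<open>auto simp: s_def split: nat.splits\<close>)
qed

section \<open>Ears and the case k = 2 of Menger's theorem\<close>

text \<open>Disjoint edge sets replace disjoint paths, so pieces can be joined without shortcutting.
  Letting the two targets differ is the strengthening that survives adding an ear; both targets
  equal to \<open>v\<close> is Menger's statement.\<close>

definition fan :: "'a \<Rightarrow> 'a set set \<Rightarrow> 'a \<Rightarrow> 'a \<Rightarrow> bool" where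
  "fan u F x y \<longleftrightarrow> (\<exists>S T. S \<subseteq> F \<and> T \<subseteq> F \<and> S \<inter> T = {} \<and> (u, x) \<in> reach S \<and> (u, y) \<in> reach T)"

lemma fanI:
  "S \<subseteq> F \<Longrightarrow> T \<subseteq> F \<Longrightarrow> S \<inter> T = {} \<Longrightarrow> (u, x) \<in> reach S \<Longrightarrow> (u, y) \<in> reach T \<Longrightarrow> fan u F x y"
  unfolding fan_def by blast

lemma fan_sym: "fan u F x y \<Longrightarrow> fan u F y x"
  unfolding fan_def by (metis inf_commute)

lemma fan_mono: "fan u F x y \<Longrightarrow> F \<subseteq> F' \<Longrightarrow> fan u F' x y"
  unfolding fan_def by (meson order_trans)

text \<open>For two vertices on the ear, the earlier one is reached through \<open>s 0\<close> and
  the later one through \<open>s N\<close>, over disjoint parts of the ear. A vertex of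
  \<open>B\<close> and one of the ear need only the part starting at \<open>s 0\<close>.\<close>

lemma fan_ear:
  assumes fan: "\<And>x y. x \<in> B \<Longrightarrow> y \<in> B \<Longrightarrow> fan u F x y"
    and F: "\<Union>F \<subseteq> B" and N: "2 \<le> N" "s 0 \<in> B" "s N \<in> B"
    and new: "\<And>t. 0 < t \<Longrightarrow> t < N \<Longrightarrow> s t \<notin> B"
    and inj: "inj_on (\<lambda>t. {s t, s (Suc t)}) {..<N}"
    and x: "x \<in> B \<union> s ` {..N}" and y: "y \<in> B \<union> s ` {..N}"
  shows "fan u (F \<union> (\<lambda>t. {s t, s (Suc t)}) ` {..<N}) x y" (is "fan u ?F' x y")
proof -
  define R where "R i j = (\<lambda>t. {s t, s (Suc t)}) ` {i..<j}" for i j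
  have R: "R i j \<subseteq> ?F'" if "j \<le> N" for i j using that by (auto simp: R_def)
  have FR: "F \<inter> R i j = {}" if "j \<le> N" for i j
  proof -
    have "{s t, s (Suc t)} \<notin> F" if "t < N" for t
      using that F new[of t] new[of "Suc t"] N by (cases "t = 0") auto
    then show ?thesis using that by (auto simp: R_def)
  qed
  have RR: "R 0 i \<inter> R j N = {}" if "i \<le> j" "i \<le> N" for i j
  proof -
    have *: "{s t, s (Suc t)} \<noteq> {s t', s (Suc t')}" if "t < i" "j \<le> t'" "t' < N" for t t'
      using inj_onD[OF inj, of t t'] that \<open>i \<le> j\<close> by force
    show ?thesis
    proof (rule equals0I)
      fix e assume "e \<in> R 0 i \<inter> R j N"
      then obtain t t' where "t < i" "e = {s t, s (Suc t)}" "j \<le> t'" "t' < N" "e = {s t', s (Suc t')}"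
        unfolding R_def by auto
      then show False using * by metis
    qed
  qed
  have reach: "(s i, s j) \<in> reach (R i j)" if "i \<le> j" for i j
    by (rule reach_seq[where s = s]) (use that in \<open>auto simp: R_def\<close>)
  have mixed: "fan u ?F' x (s t)" if "x \<in> B" "t \<le> N" for x t
  proof -
    obtain S T where ST: "S \<subseteq> F" "T \<subseteq> F" "S \<inter> T = {}" "(u, x) \<in> reach S" "(u, s 0) \<in> reach T"
      using fan[OF \<open>x \<in> B\<close> N(2)] by (auto simp: fan_def)
    have "(u, s t) \<in> reach (T \<union> R 0 t)"
      using reach_mono[OF ST(5), of "T \<union> R 0 t"] reach_mono[OF reach[of 0 t], of "T \<union> R 0 t"]
      by (auto intro: reach_trans)
    moreover have "S \<inter> (T \<union> R 0 t) = {}" using ST FR[OF that(2), of 0] by auto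
    ultimately show ?thesis using ST R[OF that(2), of 0] by (intro fanI[of S _ "T \<union> R 0 t"]) (simp_all add: le_supI1)
  qed
  have both: "fan u ?F' (s i) (s j)" if "i \<le> j" "j \<le> N" for i j
  proof -
    have i: "i \<le> N" using that by simp
    obtain S T where ST: "S \<subseteq> F" "T \<subseteq> F" "S \<inter> T = {}" "(u, s 0) \<in> reach S" "(u, s N) \<in> reach T"
      using fan[OF N(2,3)] by (auto simp: fan_def)
    have "(u, s i) \<in> reach (S \<union> R 0 i)"
      using reach_mono[OF ST(4), of "S \<union> R 0 i"] reach_mono[OF reach[of 0 i], of "S \<union> R 0 i"]
      by (auto intro: reach_trans)
    moreover have "(u, s j) \<in> reach (T \<union> R j N)"
      using reach_mono[OF ST(5), of "T \<union> R j N"] reach_mono[OF reach_sym[OF reach[OF that(2)]], of "T \<union> R j N"]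
      by (auto intro: reach_trans)
    moreover have "(S \<union> R 0 i) \<inter> (T \<union> R j N) = {}"
      using ST(1-3) RR[OF that(1) i] FR[OF i, of 0] FR[of N j] by auto
    ultimately show ?thesis
      using ST(1,2) R[OF i, of 0] R[of N j] by (intro fanI[of "S \<union> R 0 i" _ "T \<union> R j N"]) (simp_all add: le_supI1)
  qed
  consider "x \<in> B" "y \<in> B" | i where "x \<in> B" "y = s i" "i \<le> N" | i where "y \<in> B" "x = s i" "i \<le> N"
    | i j where "x = s i" "y = s j" "i \<le> N" "j \<le> N" using x y by auto
  then show ?thesis
  proof cases
    case 1 then show ?thesis by (intro fan_mono[OF fan]) auto
  next
    case 2 then show ?thesis using mixed[of x i] by simp
  next
    case 3 then show ?thesis using fan_sym[OF mixed[of y i]] by simp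
  next
    case 4 then show ?thesis using both[of i j] fan_sym[OF both[of j i]] by (cases "i \<le> j") simp_all
  qed
qed

lemma ear_union_psubset:
  assumes "2 \<le> N" "\<And>t. 0 < t \<Longrightarrow> t < N \<Longrightarrow> s t \<notin> B"
  shows "B \<subset> B \<union> s ` {..N::nat}"
proof -
  have "s 1 \<notin> B" "s 1 \<in> s ` {..N}" using assms(2)[of 1] assms(1) by auto
  then show ?thesis by blast
qed

lemma ear_subset:
  assumes "s 0 \<in> V" "\<And>t. t < N \<Longrightarrow> {s t, s (Suc t)} \<in> E" "\<Union>E \<subseteq> V"
  shows "s ` {..N::nat} \<subseteq> V"
proof
  fix v assume "v \<in> s ` {..N}"
  then obtain t where "v = s t" "t \<le> N" by auto
  then show "v \<in> V" using assms(1,3) assms(2)[of "t - 1"] by (cases t) auto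
qed

lemma conn2_fan:
  assumes "finite V" "\<Union>E \<subseteq> V" "conn2 V E" "u \<in> V" "v \<in> V"
  shows "fan u E v v"
proof -
  define P where "P B \<longleftrightarrow> u \<in> B \<and> B \<subseteq> V \<and> (\<exists>F\<subseteq>E. \<Union>F \<subseteq> B \<and> (\<forall>x\<in>B. \<forall>y\<in>B. fan u F x y))" for B
  have "P {u}" using assms(4) by (auto simp: P_def fan_def intro!: exI[of _ "{}"])
  moreover have "\<And>B. P B \<Longrightarrow> card B < Suc (card V)"
    using assms(1) by (auto simp: P_def less_Suc_eq_le intro: card_mono)
  ultimately obtain B where "P B" and max: "\<And>B'. P B' \<Longrightarrow> card B' \<le> card B"
    using ex_has_greatest_nat[of P "{u}" card "Suc (card V)"] by blast
  then obtain F where F: "u \<in> B" "B \<subseteq> V" "F \<subseteq> E" "\<Union>F \<subseteq> B" "\<And>x y. x \<in> B \<Longrightarrow> y \<in> B \<Longrightarrow> fan u F x y"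
    unfolding P_def by metis
  have "B = V"
  proof (rule ccontr)
    assume Bn: "B \<noteq> V"
    have Be: "B \<noteq> {}" using F(1) by blast
    obtain s :: "nat \<Rightarrow> 'a" and N where s: "2 \<le> N" "s 0 \<in> B" "s N \<in> B"
      "\<And>t. 0 < t \<Longrightarrow> t < N \<Longrightarrow> s t \<notin> B" "inj_on s {0<..<N}"
      "inj_on (\<lambda>t. {s t, s (Suc t)}) {..<N}" "\<And>t. t < N \<Longrightarrow> {s t, s (Suc t)} \<in> E"
      by (rule conn2_ear_exists[OF assms(3,2) F(2) Be Bn]) (rule that)
    let ?F = "F \<union> (\<lambda>t. {s t, s (Suc t)}) ` {..<N}"
    have sV: "s ` {..N} \<subseteq> V" by (rule ear_subset[where s = s and E = E]) (use s(2,7) F(2) assms(2) in auto)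
    have "\<Union>?F \<subseteq> B \<union> s ` {..N}" using F(4) by (auto simp: image_iff) 
    moreover have "?F \<subseteq> E" using F(3) s(7) by auto
    moreover have "\<forall>x\<in>B \<union> s ` {..N}. \<forall>y\<in>B \<union> s ` {..N}. fan u ?F x y"
      by (intro ballI fan_ear[where s = s, OF F(5,4) s(1-4,6)])
    ultimately have "P (B \<union> s ` {..N})"
      unfolding P_def using F(1,2) sV by (intro conjI exI[of _ ?F]) simp_all
    moreover have "card B < card (B \<union> s ` {..N})"
      using ear_union_psubset[OF s(1,4)] sV F(2) assms(1)
      by (intro psubset_card_mono) (auto intro: finite_subset)
    ultimately show False using max leD by blast
  qed
  then show ?thesis using fan_mono[OF F(5) F(3)] assms(5) by simp
qed

lemma reach_is_path:
  assumes "(u, v) \<in> reach S" "S \<subseteq> edges G" "\<Union>(edges G) \<subseteq> verts G" "u \<in> verts G"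
  obtains p where "is_path G u v p" "path_edges p \<subseteq> S"
proof -
  obtain p where p: "p \<noteq> []" "hd p = u" "last p = v" "distinct p" "path_edges p \<subseteq> S"
    using reach_obtain_path[OF assms(1)] by blast
  have "set p \<subseteq> verts G"
  proof
    fix x assume "x \<in> set p"
    then obtain i where i: "i < length p" "x = p ! i" by (auto simp: in_set_conv_nth)
    show "x \<in> verts G"
    proof (cases i)
      case 0 then show ?thesis using i p assms(4) by (simp add: hd_conv_nth)
    next
      case (Suc j) then show ?thesis using i p(5) path_edges_nth[of j p] assms(2,3) by blast
    qed
  qed
  then show ?thesis using that[of p] p assms(2) by (auto simp: is_path_def)
qed

lemma conn2_two_paths:
  assumes "simple_graph G" "E \<subseteq> edges G" "conn2 (verts G) E" "u \<in> verts G" "v \<in> verts G" "u \<noteq> v"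
  obtains p q where "is_path G u v p" "is_path G u v q" "path_edges p \<subseteq> E" "path_edges q \<subseteq> E"
    "path_edges p \<inter> path_edges q = {}" "p \<noteq> q"
proof -
  have V: "finite (verts G)" "\<Union>(edges G) \<subseteq> verts G" using assms(1) by (auto simp: simple_graph_def)
  have "\<Union>E \<subseteq> verts G" using assms(2) V by auto
  then have "fan u E v v" using conn2_fan[OF V(1)] assms(3-5) by blast
  then obtain S T where ST: "S \<subseteq> E" "T \<subseteq> E" "S \<inter> T = {}" "(u, v) \<in> reach S" "(u, v) \<in> reach T"
    by (auto simp: fan_def)
  have "S \<subseteq> edges G" "T \<subseteq> edges G" using ST assms(2) by auto
  then obtain p q where p: "is_path G u v p" "path_edges p \<subseteq> S" and q: "is_path G u v q" "path_edges q \<subseteq> T"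
    using reach_is_path[OF ST(4) _ V(2) assms(4)] reach_is_path[OF ST(5) _ V(2) assms(4)] by metis
  have "path_edges p \<noteq> {}"
    using p assms(6) by (intro path_edges_nonempty) (auto simp: is_path_def)
  then have "p \<noteq> q" using p q ST by blast
  then show ?thesis using that[of p q] p q ST by blast
qed

lemma two_disjoint_elements:
  assumes "edge_disjoint P" "finite P" "2 \<le> card P"
  obtains p q where "p \<in> P" "q \<in> P" "p \<noteq> q" "path_edges p \<inter> path_edges q = {}"
proof -
  obtain p where p: "p \<in> P" using assms by fastforce
  have "card (P - {p}) \<ge> 1" using assms p by simp
  then obtain q where "q \<in> P - {p}" by (metis One_nat_def Suc_le_D card.empty ex_in_conv nat.distinct(1))
  then show ?thesis using that[of p q] p assms(1) by (auto simp: edge_disjoint_def pairwise_def disjnt_def)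
qed

text \<open>A deletion destroys at most one of two edge-disjoint paths; the converse is Menger's
  theorem via fans. From here on, single deletions replace families of paths.\<close>

lemma k_edge_connected_2_iff:
  "k_edge_connected 2 G \<longleftrightarrow> simple_graph G \<and> 2 \<le> card (verts G) \<and> conn2 (verts G) (edges G)"
proof
  assume k: "k_edge_connected 2 G"
  have "(u, v) \<in> reach (edges G - {e})" if "u \<in> verts G" "v \<in> verts G" for e u v
  proof (cases "u = v")
    case False
    have "\<exists>P. finite P \<and> card P \<ge> 2 \<and> edge_disjoint P \<and> (\<forall>p\<in>P. is_path G u v p)"
      using k that False by (simp add: k_edge_connected_def)
    then obtain P where P: "finite P" "card P \<ge> 2" "edge_disjoint P" "\<forall>p\<in>P. is_path G u v p"
      by blast
    obtain p q where pq: "p \<in> P" "q \<in> P" "path_edges p \<inter> path_edges q = {}"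
      using two_disjoint_elements[OF P(3,1,2)] by blast
    then have "path_edges p \<subseteq> edges G - {e} \<or> path_edges q \<subseteq> edges G - {e}"
      using P(4) by (auto simp: is_path_def)
    then show ?thesis
      using is_path_reach[of G u v p] is_path_reach[of G u v q] P(4) pq(1,2) by auto
  qed simp
  then show "simple_graph G \<and> 2 \<le> card (verts G) \<and> conn2 (verts G) (edges G)"
    using k by (auto simp: k_edge_connected_def conn2_def)
next
  assume G: "simple_graph G \<and> 2 \<le> card (verts G) \<and> conn2 (verts G) (edges G)"
  show "k_edge_connected 2 G"
    unfolding k_edge_connected_def
  proof (intro conjI ballI impI)
    fix u v assume "u \<in> verts G" "v \<in> verts G" "u \<noteq> v"
    then obtain p q where "is_path G u v p" "is_path G u v q" "path_edges p \<inter> path_edges q = {}" "p \<noteq> q"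
      using conn2_two_paths[of G "edges G" u v] G by (metis order_refl)
    then show "\<exists>P. finite P \<and> 2 \<le> card P \<and> edge_disjoint P \<and> (\<forall>p\<in>P. is_path G u v p)"
      by (intro exI[of _ "{p, q}"]) (auto simp: edge_disjoint_def pairwise_def disjnt_def)
  qed (use G in auto)
qed

text \<open>An ear with \<open>N\<close> edges brings \<open>N - 1\<close> new vertices, and
  \<open>N \<le> 2 * (N - 1)\<close> because \<open>N\<close> is at least 2.\<close>

lemma conn2_spanning_extension:
  assumes "finite V" "\<Union>E \<subseteq> V" "conn2 V E" "B \<subseteq> V" "B \<noteq> {}" "D \<subseteq> E" "conn2 B D" "finite E"
  shows "\<exists>D'\<subseteq>E. conn2 V D' \<and> card D' \<le> card D + 2 * card (V - B)"
  using assms(4-7)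
proof (induction "card (V - B)" arbitrary: B D rule: less_induct)
  case less
  show ?case
  proof (cases "B = V")
    case True then show ?thesis using less.prems by (intro exI[of _ D]) simp
  next
    case False
    obtain s :: "nat \<Rightarrow> 'a" and N where s: "2 \<le> N" "s 0 \<in> B" "s N \<in> B"
      "\<And>t. 0 < t \<Longrightarrow> t < N \<Longrightarrow> s t \<notin> B" "inj_on s {0<..<N}"
      "inj_on (\<lambda>t. {s t, s (Suc t)}) {..<N}" "\<And>t. t < N \<Longrightarrow> {s t, s (Suc t)} \<in> E"
      by (rule conn2_ear_exists[OF assms(3,2) less.prems(1,2) False]) (rule that)
    define D1 where "D1 = D \<union> (\<lambda>t. {s t, s (Suc t)}) ` {..<N}"
    define B1 where "B1 = B \<union> s ` {..N}"
    have sV: "s ` {..N} \<subseteq> V" by (rule ear_subset[where s = s and E = E]) (use s(2,7) less.prems(1) assms(2) in auto)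
    have conn: "conn2 B1 D1"
      unfolding B1_def by (rule conn2_ear[where s = s, OF less.prems(4) _ s(2,3,6)]) (auto simp: D1_def)
    have "s ` {0<..<N} \<subseteq> V - B" using s(4) sV by fastforce
    moreover have "V - B1 \<subseteq> (V - B) - s ` {0<..<N}" unfolding B1_def by force
    ultimately have "card (V - B1) \<le> card (V - B) - card (s ` {0<..<N})" "card (s ` {0<..<N}) \<le> card (V - B)"
      using assms(1) by (auto intro!: card_mono simp flip: card_Diff_subset)
    then have c: "card (V - B1) + (N - 1) \<le> card (V - B)" using card_image[OF s(5)] by simp
    have "card D1 \<le> card D + N"
      unfolding D1_def using card_Un_le[of D "(\<lambda>t. {s t, s (Suc t)}) ` {..<N}"]
        card_image_le[of "{..<N}" "\<lambda>t. {s t, s (Suc t)}"] by simp 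
    moreover have "D1 \<subseteq> E" "B1 \<subseteq> V" "B1 \<noteq> {}" "card (V - B1) < card (V - B)"
      using s(7) less.prems(1-3) sV c s(1) by (auto simp: D1_def B1_def)
    then have "\<exists>D'\<subseteq>E. conn2 V D' \<and> card D' \<le> card D1 + 2 * card (V - B1)"
      using less.hyps[of B1 D1] conn by simp
    then obtain D' where "D' \<subseteq> E" "conn2 V D'" "card D' \<le> card D1 + 2 * card (V - B1)"
      by blast
    ultimately show ?thesis using c s(1) by (intro exI[of _ D']) auto
  qed
qed

lemma conn2_edge_exists:
  assumes "conn2 V E" "2 \<le> card V"
  shows "E \<noteq> {}"
proof
  assume e: "E = {}"
  obtain x where x: "x \<in> V" using assms(2) by fastforce
  have "\<not> V \<subseteq> {x}" using assms(2) card_mono[of "{x}" V] by auto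
  then obtain y where "y \<in> V" "y \<noteq> x" by auto
  then show False using reach_Union(1)[of x y "{}"] assms(1) x e by (auto simp: conn2_def)
qed

section \<open>Blocks of a connected edge set\<close>

text \<open>Contracting the fibres of \<open>f\<close> leaves a connected graph, which has at least
  one edge less than vertices. With \<open>f = id\<close> this is the tree bound; with the block map
  it bounds the number of blocks by the number of bridges.\<close>

lemma card_image_le_crossing:
  assumes "finite V" "finite E" "\<And>u v. u \<in> V \<Longrightarrow> v \<in> V \<Longrightarrow> (u, v) \<in> reach E" "\<Union>E \<subseteq> V"
  shows "card (f ` V) \<le> 1 + card {e \<in> E. \<exists>x\<in>e. \<exists>y\<in>e. f x \<noteq> f y}"
proof (cases "V = {}")
  case False
  define C where "C = {e \<in> E. \<exists>x\<in>e. \<exists>y\<in>e. f x \<noteq> f y}"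
  \<comment> \<open>Values are collected one at a time: connectedness supplies an edge from the
    collected fibres to a new one, and this edge was not counted before since only edges with both
    values in \<open>Y\<close> are.\<close>
  have "\<exists>Y\<subseteq>f ` V. card Y = n \<and> n \<le> 1 + card {e \<in> C. f ` e \<subseteq> Y}" if "1 \<le> n" "n \<le> card (f ` V)" for n
    using that
  proof (induction n rule: dec_induct)
    case base
    obtain v where "v \<in> V" using False by auto
    then show ?case by (intro exI[of _ "{f v}"]) auto
  next
    case (step n)
    then obtain Y where Y: "Y \<subseteq> f ` V" "card Y = n" "n \<le> 1 + card {e \<in> C. f ` e \<subseteq> Y}" by auto
    have finY: "finite Y" using Y(1) assms(1) finite_subset by blast
    have "Y \<noteq> {}" using Y(2) step.hyps(1) by auto
    then obtain u where u: "u \<in> V" "f u \<in> Y" using Y(1) by blast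
    have "\<not> f ` V \<subseteq> Y" using card_mono[OF finY, of "f ` V"] Y(2) step.prems by auto
    then obtain v where v: "v \<in> V" "f v \<notin> Y" by auto
    obtain x y where xy: "f x \<in> Y" "f y \<notin> Y" "{x, y} \<in> E"
      using reach_cross[OF assms(3)[OF u(1) v(1)], of "{x. f x \<in> Y}"] u v by auto
    have "y \<in> V" using xy assms(4) by auto
    let ?e = "{x, y}"
    have "?e \<in> C" using xy by (auto simp: C_def)
    then have "insert ?e {e \<in> C. f ` e \<subseteq> Y} \<subseteq> {e \<in> C. f ` e \<subseteq> insert (f y) Y}" using xy by auto
    moreover have "finite C" using assms(2) by (simp add: C_def)
    ultimately have "card (insert ?e {e \<in> C. f ` e \<subseteq> Y}) \<le> card {e \<in> C. f ` e \<subseteq> insert (f y) Y}"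
      by (intro card_mono) auto
    moreover have "card (insert ?e {e \<in> C. f ` e \<subseteq> Y}) = Suc (card {e \<in> C. f ` e \<subseteq> Y})"
      using xy \<open>finite C\<close> by (subst card_insert_disjoint) auto
    ultimately show ?case using Y \<open>y \<in> V\<close> xy(2) finY by (intro exI[of _ "insert (f y) Y"]) auto
  qed
  from this[of "card (f ` V)"] have "\<exists>Y\<subseteq>f ` V. card Y = card (f ` V) \<and> card (f ` V) \<le> 1 + card {e \<in> C. f ` e \<subseteq> Y}"
    using False assms(1) by (simp add: Suc_le_eq card_gt_0_iff)
  moreover have "card {e \<in> C. f ` e \<subseteq> Y} \<le> card C" for Y
    using assms(2) by (intro card_mono) (auto simp: C_def)
  ultimately show ?thesis unfolding C_def[symmetric] by (meson add_left_mono order_trans)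
qed simp

lemma card_le_Suc_card_edges:
  assumes "finite V" "finite E" "\<And>u v. u \<in> V \<Longrightarrow> v \<in> V \<Longrightarrow> (u, v) \<in> reach E" "\<Union>E \<subseteq> V"
  shows "card V \<le> 1 + card E"
proof -
  have "card {e \<in> E. \<exists>x\<in>e. \<exists>y\<in>e. id x \<noteq> id y} \<le> card E" using assms(2) by (intro card_mono) auto
  then show ?thesis using card_image_le_crossing[OF assms, of id] by simp
qed

section \<open>Two-edge-connected components\<close>

definition tied :: "'a set set \<Rightarrow> 'a \<Rightarrow> 'a \<Rightarrow> bool" where
  "tied F u v \<longleftrightarrow> (\<forall>e. (u, v) \<in> reach (F - {e}))"

lemma tied_refl [simp]: "tied F u u" by (simp add: tied_def)

lemma tied_sym: "tied F u v \<Longrightarrow> tied F v u" by (auto simp: tied_def intro: reach_sym)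

lemma tied_trans: "tied F u v \<Longrightarrow> tied F v w \<Longrightarrow> tied F u w"
  unfolding tied_def using reach_trans[of u v _ w] by auto

lemma tied_reach: "tied F u v \<Longrightarrow> (u, v) \<in> reach F"
  unfolding tied_def using reach_mono[of u v "F - {{}}" F] by auto

lemma path_edges_distinct_card:
  "distinct p \<Longrightarrow> e \<in> path_edges p \<Longrightarrow> card e = 2"
  by (induction p rule: induct_list012) (auto simp: card_2_iff)

text \<open>A path between two vertices of the class stays in it: an edge lies on at most one side
  of an intermediate vertex \<open>a\<close>, so after any deletion \<open>a\<close> still reaches
  one end, and the ends are tied to each other.\<close>

lemma conn2_tied_class:
  assumes "X = {v. tied F u v}"
  shows "conn2 X {e \<in> F. e \<subseteq> X}"
  unfolding conn2_def
proof (intro allI ballI)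
  fix e x y assume "x \<in> X" "y \<in> X"
  then have xy: "tied F x y" "tied F u x" using assms tied_trans tied_sym by fastforce+
  then obtain p where p: "p \<noteq> []" "hd p = x" "last p = y" "distinct p" "path_edges p \<subseteq> F - {e}"
    using reach_obtain_path[of x y "F - {e}"] by (auto simp: tied_def)
  have "set p \<subseteq> X"
  proof
    fix a assume "a \<in> set p"
    then obtain l r where lr: "p = l @ a # r" by (auto simp: in_set_conv_decomp)
    have l: "path_edges (l @ [a]) \<subseteq> path_edges p"
      unfolding lr using path_edges_append[of "l @ [a]" r] by (cases r) auto
    have r: "path_edges (a # r) \<subseteq> path_edges p"
      unfolding lr using path_edges_append[of l "a # r"] by (cases l) auto
    have "(x, a) \<in> reach (F - {f})" for f
    proof (cases "f \<in> path_edges (l @ [a])")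
      case False
      then have "path_edges (l @ [a]) \<subseteq> F - {f}" using l p(5) by auto
      then have "(hd (l @ [a]), last (l @ [a])) \<in> reach (F - {f})" by (intro reach_path_edges) auto
      then show ?thesis using p(2) lr by (cases l) auto
    next
      case True
      then have f: "card f = 2" "f \<subseteq> set (l @ [a])"
        using path_edges_distinct_card[of "l @ [a]" f] p(4) lr path_edges_subset[of "l @ [a]"] by auto
      have "f \<notin> path_edges (a # r)"
      proof
        assume "f \<in> path_edges (a # r)"
        then have "f \<subseteq> set (a # r)" using path_edges_subset[of "a # r"] by blast
        then have "f \<subseteq> {a}" using f(2) p(4) lr by auto
        then show False using f(1) card_mono[of "{a}" f] by simp
      qed
      then have "path_edges (a # r) \<subseteq> F - {f}" using r p(5) by auto
      then have "(hd (a # r), last (a # r)) \<in> reach (F - {f})" by (intro reach_path_edges) auto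
      then have "(a, y) \<in> reach (F - {f})" using p(3) lr by auto
      then show ?thesis using xy(1) reach_trans reach_sym unfolding tied_def by metis
    qed
    then have "tied F x a" by (simp add: tied_def)
    then show "a \<in> X" using tied_trans[OF xy(2), of a] assms by simp
  qed
  then have "path_edges p \<subseteq> {e \<in> F. e \<subseteq> X} - {e}" using p(5) path_edges_subset[of p] by blast
  then show "(x, y) \<in> reach ({e \<in> F. e \<subseteq> X} - {e})" using reach_path_edges p(1-3) by metis
qed

text \<open>These are the 2-edge-connected components, singletons included, not the blocks of vertex
  connectivity; hence they partition the vertices.\<close>

definition blocks :: "'a set set \<Rightarrow> 'a set set" where
  "blocks F = (\<lambda>u. {v. tied F u v}) ` \<Union>F"

definition inside :: "'a set set \<Rightarrow> 'a set \<Rightarrow> 'a set set" where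
  "inside F X = {e \<in> F. e \<subseteq> X}"

text \<open>A block contributes one unit when \<^term>\<open>B\<close> meets it and its edges only when it lies in \<^term>\<open>B\<close>:
  completing a block thus increases the weight by what gluing or inserting it into a
  subgraph spanning \<^term>\<open>B\<close> costs. The total never exceeds \<^term>\<open>card F + 1\<close>.\<close>

definition weight :: "'a set set \<Rightarrow> 'a set \<Rightarrow> nat" where
  "weight F B = (\<Sum>X\<in>blocks F. (if X \<inter> B = {} then 0 else 1) + (if X \<subseteq> B then card (inside F X) else 0))"

locale connected_edge_set =
  fixes F :: "'a set set"
  assumes finF: "finite F" and card2: "\<And>e. e \<in> F \<Longrightarrow> card e = 2"
    and connected: "\<And>x y. x \<in> \<Union>F \<Longrightarrow> y \<in> \<Union>F \<Longrightarrow> (x, y) \<in> reach F"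
    and nonempty: "F \<noteq> {}"
begin

lemma finite_verts: "finite (\<Union>F)"
proof (rule finite_Union[OF finF])
  show "finite e" if "e \<in> F" for e using card2[OF that] card_ge_0_finite[of e] by simp
qed

lemma finite_blocks: "finite (blocks F)"
  using finite_verts by (simp add: blocks_def)

lemma block_nonempty: "X \<in> blocks F \<Longrightarrow> X \<noteq> {}"
  unfolding blocks_def using tied_refl[of F] by (elim imageE) blast

lemma block_subset: "X \<in> blocks F \<Longrightarrow> X \<subseteq> \<Union>F"
proof
  fix v assume "X \<in> blocks F" "v \<in> X"
  then obtain u where "u \<in> \<Union>F" "tied F u v" unfolding blocks_def by auto
  then show "v \<in> \<Union>F" using reach_Union(1)[OF tied_reach, of F u v] by (cases "u = v") auto
qed

lemma block_of: "x \<in> \<Union>F \<Longrightarrow> {v. tied F x v} \<in> blocks F"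
  unfolding blocks_def by (rule imageI)

lemma Union_blocks: "\<Union>(blocks F) = \<Union>F"
proof
  show "\<Union>F \<subseteq> \<Union>(blocks F)"
  proof
    fix x assume "x \<in> \<Union>F"
    from block_of[OF this] show "x \<in> \<Union>(blocks F)" by (rule UnionI) simp
  qed
qed (use block_subset in blast)

lemma block_eq: "X \<in> blocks F \<Longrightarrow> x \<in> X \<Longrightarrow> X = {v. tied F x v}"
proof -
  assume "X \<in> blocks F" "x \<in> X"
  then obtain u where u: "X = {v. tied F u v}" "tied F u x" unfolding blocks_def by auto
  have "tied F u v \<longleftrightarrow> tied F x v" for v
    using tied_trans[OF u(2), of v] tied_trans[OF tied_sym[OF u(2)], of v] by blast
  then show ?thesis using u(1) by simp
qed

lemma blocks_disjoint: "X \<in> blocks F \<Longrightarrow> Y \<in> blocks F \<Longrightarrow> x \<in> X \<Longrightarrow> x \<in> Y \<Longrightarrow> X = Y"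
  using block_eq[of X x] block_eq[of Y x] by simp

lemma finite_block: "X \<in> blocks F \<Longrightarrow> finite X"
  using finite_subset[OF block_subset finite_verts] .

lemma finite_inside: "finite (inside F X)"
  using finF by (simp add: inside_def)

lemma conn2_block: "X \<in> blocks F \<Longrightarrow> conn2 X (inside F X)"
  unfolding blocks_def inside_def by (elim imageE) (simp add: conn2_tied_class)

lemma conn2_reach: "conn2 X D \<Longrightarrow> x \<in> X \<Longrightarrow> y \<in> X \<Longrightarrow> (x, y) \<in> reach (D - {e})"
  by (simp add: conn2_def)

lemma card_block_le:
  assumes "X \<in> blocks F"
  shows "card X \<le> card (inside F X) + 1"
proof -
  have "(u, v) \<in> reach (inside F X)" if "u \<in> X" "v \<in> X" for u v
    using conn2_reach[OF conn2_block[OF assms] that] reach_mono Diff_subset by metis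
  then have "card X \<le> 1 + card (inside F X)"
    using finite_block[OF assms] finite_inside
    by (intro card_le_Suc_card_edges) (auto simp: inside_def)
  then show ?thesis by simp
qed

text \<open>A nontrivial block remains connected when one of its edges is deleted, which improves
  the tree bound by one.\<close>

lemma card_block_le':
  assumes "X \<in> blocks F" "2 \<le> card X"
  shows "card X \<le> card (inside F X)"
proof -
  have "inside F X \<noteq> {}" using card_block_le[OF assms(1)] assms(2) by auto
  then obtain e where e: "e \<in> inside F X" by auto
  have "card X \<le> 1 + card (inside F X - {e})"
    using finite_block[OF assms(1)] finite_inside conn2_reach[OF conn2_block[OF assms(1)]]
    by (intro card_le_Suc_card_edges) (auto simp: inside_def)
  then show ?thesis using e finite_inside[of X] card_gt_0_iff[of "inside F X"] by (auto simp: card_Diff_singleton)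
qed

lemma weight_mono: "B \<subseteq> B' \<Longrightarrow> weight F B \<le> weight F B'"
  unfolding weight_def by (intro sum_mono) auto

lemma weight_top:
  assumes "\<Union>F \<subseteq> V"
  shows "weight F V = (\<Sum>X\<in>blocks F. card (inside F X) + 1)"
  unfolding weight_def
proof (intro sum.cong refl)
  fix X assume "X \<in> blocks F"
  then have "X \<subseteq> V" "X \<noteq> {}" using assms block_subset block_nonempty by blast+
  then show "(if X \<inter> V = {} then 0 else 1) + (if X \<subseteq> V then card (inside F X) else 0) = card (inside F X) + 1"
    by (auto simp: Int_absorb2)
qed

text \<open>Contracting the blocks shows that there are at most \<open>1 + card C\<close> of them,
  where \<open>C\<close> consists of the edges between blocks; the edges inside blocks are disjoint
  families outside \<open>C\<close>.\<close>

lemma weight_top_le: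
  assumes "\<Union>F \<subseteq> V"
  shows "weight F V \<le> card F + 1"
proof -
  define f where "f u = {v. tied F u v}" for u
  define C where "C = {e \<in> F. \<exists>x\<in>e. \<exists>y\<in>e. f x \<noteq> f y}"
  have "card (blocks F) \<le> 1 + card C"
    unfolding blocks_def C_def f_def[symmetric]
    by (rule card_image_le_crossing) (use finF finite_verts connected in auto)
  moreover have "(\<Sum>X\<in>blocks F. card (inside F X)) = card (\<Union>X\<in>blocks F. inside F X)"
  proof (rule card_UN_disjoint[symmetric])
    show "\<forall>X\<in>blocks F. \<forall>Y\<in>blocks F. X \<noteq> Y \<longrightarrow> inside F X \<inter> inside F Y = {}"
    proof (intro ballI impI equals0I)
      fix X Y e assume *: "X \<in> blocks F" "Y \<in> blocks F" "X \<noteq> Y" "e \<in> inside F X \<inter> inside F Y"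
      then obtain x where "x \<in> e" using card2[of e] by (fastforce simp: inside_def)
      then show False using blocks_disjoint[of X Y x] * by (auto simp: inside_def)
    qed
  qed (use finite_blocks finite_inside in auto)
  moreover have "card (\<Union>X\<in>blocks F. inside F X) \<le> card (F - C)"
  proof (rule card_mono)
    show "(\<Union>X\<in>blocks F. inside F X) \<subseteq> F - C"
    proof
      fix e assume "e \<in> (\<Union>X\<in>blocks F. inside F X)"
      then obtain X where X: "X \<in> blocks F" "e \<in> F" "e \<subseteq> X" by (auto simp: inside_def)
      have "f x = X" if "x \<in> e" for x using block_eq[OF X(1), of x] X(3) that by (auto simp: f_def)
      then show "e \<in> F - C" using X(2) by (auto simp: C_def)
    qed
  qed (use finF in auto)
  moreover have "card (F - C) = card F - card C" "card C \<le> card F"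
    using finF by (auto simp: C_def intro!: card_Diff_subset card_mono)
  ultimately show ?thesis unfolding weight_top[OF assms] sum.distrib by simp
qed

lemma sum_card_blocks_diff: "(\<Sum>X\<in>blocks F. card (X - B)) = card (\<Union>F - B)"
proof -
  have "card (\<Union>X\<in>blocks F. X - B) = (\<Sum>X\<in>blocks F. card (X - B))"
    by (rule card_UN_disjoint) (use finite_blocks finite_block blocks_disjoint in auto)
  moreover have "(\<Union>X\<in>blocks F. X - B) = \<Union>F - B" using Union_blocks by auto
  ultimately show ?thesis by simp
qed

text \<open>Blockwise: a block missed by \<open>B\<close> gains its edges and one unit, at least its
  vertex number; a block met by \<open>B\<close> but not contained in it gains its edges, at least
  its number of new vertices, one vertex being old.\<close>

lemma weight_gain:
  assumes "\<Union>F \<subseteq> V"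
  shows "weight F B + card (\<Union>F - B) \<le> weight F V"
proof -
  have "weight F B + (\<Sum>X\<in>blocks F. card (X - B)) = (\<Sum>X\<in>blocks F. (if X \<inter> B = {} then 0 else 1)
      + (if X \<subseteq> B then card (inside F X) else 0) + card (X - B))"
    by (simp only: weight_def sum.distrib)
  also have "\<dots> \<le> weight F V"
    unfolding weight_top[OF assms]
  proof (rule sum_mono)
    fix X assume X: "X \<in> blocks F"
    have "card (X - B) \<le> card (inside F X)" if "X \<inter> B \<noteq> {}"
    proof -
      have "X - B \<subset> X" using that by auto
      then have "card (X - B) < card X" using finite_block[OF X] by (rule psubset_card_mono[rotated])
      then show ?thesis using card_block_le[OF X] by simp
    qed
    moreover have "card (X - B) \<le> card (inside F X) + 1"
      using card_block_le[OF X] card_mono[of X "X - B"] finite_block[OF X] by auto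
    moreover have "X \<subseteq> B \<Longrightarrow> card (X - B) = 0" by (simp add: Diff_eq_empty_iff[THEN iffD2])
    moreover have "X \<subseteq> B \<Longrightarrow> X \<inter> B \<noteq> {}" using block_nonempty[OF X] by auto
    ultimately show "(if X \<inter> B = {} then 0 else 1) + (if X \<subseteq> B then card (inside F X) else 0)
        + card (X - B) \<le> card (inside F X) + 1"
      by (cases "X \<subseteq> B"; cases "X \<inter> B = {}") simp_all
  qed
  finally show ?thesis using sum_card_blocks_diff by simp
qed

lemma weight_top_ge:
  assumes "\<Union>F \<subseteq> V"
  shows "card (\<Union>F) \<le> weight F V"
  using weight_gain[OF assms, of "{}"] by simp

lemma weight_top_ge':
  assumes "\<Union>F \<subseteq> V" "X \<in> blocks F" "2 \<le> card X"
  shows "card (\<Union>F) + 1 \<le> weight F V"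
proof -
  have "weight F X + card (\<Union>F - X) \<le> weight F V" by (rule weight_gain[OF assms(1)])
  moreover have "1 + card (inside F X) \<le> weight F X"
    using sum_mono2[of "blocks F" "{X}"  "\<lambda>Y. (if Y \<inter> X = {} then 0 else 1) + (if Y \<subseteq> X then card (inside F Y) else 0)"]
      finite_blocks assms(2) block_nonempty[OF assms(2)] by (auto simp: weight_def)
  moreover have "card (\<Union>F - X) + card X = card (\<Union>F)"
    using block_subset[OF assms(2)] finite_verts by (simp add: card_Diff_subset card_mono finite_subset)
  ultimately show ?thesis using card_block_le'[OF assms(2,3)] by linarith
qed

lemma weight_insert_block:
  assumes "X \<in> blocks F" "\<not> X \<subseteq> B"
  shows "weight F B + card (inside F X) + (if X \<inter> B = {} then 1 else 0) \<le> weight F (B \<union> X)"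
proof -
  let ?t = "\<lambda>B Y. (if Y \<inter> B = {} then 0 else 1) + (if Y \<subseteq> B then card (inside F Y) else 0)"
  have "weight F B = ?t B X + (\<Sum>Y\<in>blocks F - {X}. ?t B Y)"
    "weight F (B \<union> X) = ?t (B \<union> X) X + (\<Sum>Y\<in>blocks F - {X}. ?t (B \<union> X) Y)"
    unfolding weight_def by (rule sum.remove[OF finite_blocks assms(1)])+
  moreover have "(\<Sum>Y\<in>blocks F - {X}. ?t B Y) \<le> (\<Sum>Y\<in>blocks F - {X}. ?t (B \<union> X) Y)"
    by (intro sum_mono) auto
  moreover have "?t (B \<union> X) X = 1 + card (inside F X)" using block_nonempty[OF assms(1)] by auto
  ultimately show ?thesis using assms(2) by auto
qed

lemma weight_trivial_blocks:
  assumes "\<And>X. X \<in> blocks F \<Longrightarrow> card X = 1"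
  shows "card (\<Union>F \<inter> B) \<le> weight F B"
proof -
  have "card (\<Union>X\<in>blocks F. X \<inter> B) = (\<Sum>X\<in>blocks F. card (X \<inter> B))"
    by (rule card_UN_disjoint) (use finite_blocks finite_block blocks_disjoint in auto)
  moreover have "(\<Union>X\<in>blocks F. X \<inter> B) = \<Union>F \<inter> B" using Union_blocks by auto
  moreover have "(\<Sum>X\<in>blocks F. card (X \<inter> B)) \<le> weight F B"
    unfolding weight_def
  proof (rule sum_mono)
    fix X assume X: "X \<in> blocks F"
    have "card (X \<inter> B) \<le> 1" using card_mono[of X "X \<inter> B"] finite_block[OF X] assms[OF X] by auto
    then show "card (X \<inter> B) \<le> (if X \<inter> B = {} then 0 else 1) + (if X \<subseteq> B then card (inside F X) else 0)"
      by auto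
  qed
  ultimately show ?thesis by simp
qed

lemma weight_ge_2:
  assumes "X \<in> blocks F" "Y \<in> blocks F" "X \<noteq> Y" "X \<inter> B \<noteq> {}" "Y \<inter> B \<noteq> {}"
  shows "2 \<le> weight F B"
proof -
  have "(\<Sum>Z\<in>{X, Y}. (if Z \<inter> B = {} then 0 else 1) + (if Z \<subseteq> B then card (inside F Z) else 0)) \<le> weight F B"
    unfolding weight_def by (intro sum_mono2) (use finite_blocks assms in auto)
  then show ?thesis using assms by auto
qed

end

section \<open>Colourings with connected classes\<close>

text \<open>\<open>D\<close> without \<open>ab\<close> still connects \<open>B\<close>, which
  settles deletions at \<open>v\<close>; for any other deletion the path \<open>a v b\<close> stands
  in for \<open>ab\<close>.\<close>

lemma conn2_subdivide:
  assumes "conn2 B D" "a \<in> B" "b \<in> B" "a \<noteq> b" "\<Union>D \<subseteq> B" "v \<notin> B"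
  shows "conn2 (insert v B) (insert {v, a} (insert {v, b} (D - {{a, b}})))" (is "conn2 _ ?D")
proof (rule conn2_extend)
  show "conn2 B ?D"
    unfolding conn2_def
  proof (intro allI ballI)
    fix e x y assume xy: "x \<in> B" "y \<in> B"
    show "(x, y) \<in> reach (?D - {e})"
    proof (cases "v \<in> e")
      case True
      then have "D - {{a, b}} \<subseteq> ?D - {e}" using assms(5,6) by auto
      moreover have "(x, y) \<in> reach (D - {{a, b}})" using xy assms(1) by (simp add: conn2_def)
      ultimately show ?thesis using reach_mono by metis
    next
      case False
      have "(a, v) \<in> reach (?D - {e})" "(v, b) \<in> reach (?D - {e})"
        using False by (auto simp: insert_commute intro!: reach_edge)
      then have ab: "(a, b) \<in> reach (?D - {e})" by (rule reach_trans)
      show ?thesis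
      proof (rule reach_subst)
        show "(x, y) \<in> reach (D - {e})" using xy assms(1) by (simp add: conn2_def)
        fix w z assume wz: "{w, z} \<in> D - {e}"
        show "(w, z) \<in> reach (?D - {e})"
        proof (cases "{w, z} = {a, b}")
          case True
          then show ?thesis using ab reach_sym[OF ab] by (auto simp: doubleton_eq_iff)
        next
          case False
          then show ?thesis using wz by (intro reach_edge) auto
        qed
      qed
    qed
  qed
  fix w e assume "w \<in> insert v B" "w \<notin> B"
  then have [simp]: "w = v" by auto
  show "\<exists>c\<in>B. (w, c) \<in> reach (?D - {e})"
  proof (cases "e = {v, a}")
    case True
    then have "(v, b) \<in> reach (?D - {e})"
      using assms(2-4,6) by (intro reach_edge) (auto simp: doubleton_eq_iff)
    then show ?thesis using assms(3) by auto
  next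
    case False
    then have "(v, a) \<in> reach (?D - {e})" by (intro reach_edge) auto
    then show ?thesis using assms(2) by auto
  qed
qed auto

lemma sum_card_Collect_swap:
  assumes "finite A" "finite B"
  shows "(\<Sum>x\<in>A. card {y\<in>B. R x y}) = (\<Sum>y\<in>B. card {x\<in>A. R x y})"
proof -
  have *: "card {y\<in>C. Q y} = (\<Sum>y\<in>C. if Q y then 1 else 0)" if "finite C" for C and Q :: "'z \<Rightarrow> bool"
    using that by (simp add: sum.If_cases Int_def)
  show ?thesis using assms by (simp add: * sum.swap[of _ A B])
qed

text \<open>The colour type is free because a split colour will be a pair of an old colour and a
  component. \<open>two_ways\<close> is what two edge-disjoint monochromatic paths provide: in one
  class they make their ends tied, otherwise they lie in two classes.\<close>

locale coloured =
  fixes V :: "'a set" and E :: "'a set set" and \<phi> :: "'a set \<Rightarrow> 'b"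
  assumes finV: "finite V" and edge: "\<And>e. e \<in> E \<Longrightarrow> e \<subseteq> V" "\<And>e. e \<in> E \<Longrightarrow> card e = 2"
    and conn2_VE: "conn2 V E" and card_V: "2 \<le> card V"
    and connected_class: "\<And>e x y. e \<in> E \<Longrightarrow> x \<in> \<Union>{f \<in> E. \<phi> f = \<phi> e} \<Longrightarrow> y \<in> \<Union>{f \<in> E. \<phi> f = \<phi> e} \<Longrightarrow>
      (x, y) \<in> reach {f \<in> E. \<phi> f = \<phi> e}"
    and two_ways: "\<And>u v. u \<in> V \<Longrightarrow> v \<in> V \<Longrightarrow> u \<noteq> v \<Longrightarrow>
      (\<exists>j. tied {f \<in> E. \<phi> f = j} u v) \<or>
      (\<exists>i j. i \<noteq> j \<and> (u, v) \<in> reach {f \<in> E. \<phi> f = i} \<and> (u, v) \<in> reach {f \<in> E. \<phi> f = j})"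
begin

definition cls :: "'b \<Rightarrow> 'a set set" where "cls j = {f \<in> E. \<phi> f = j}"
definition P :: "'b set" where "P = \<phi> ` E"
definition Vs :: "'b \<Rightarrow> 'a set" where "Vs j = \<Union>(cls j)"

lemma finE: "finite E"
  using finV edge(1) by (intro finite_subset[of E "Pow V"]) auto

lemma finP: "finite P"
  using finE by (simp add: P_def)

lemma connected_edge_set_cls: "j \<in> P \<Longrightarrow> connected_edge_set (cls j)"
proof -
  assume "j \<in> P"
  then obtain e where e: "e \<in> E" "cls j = {f \<in> E. \<phi> f = \<phi> e}" by (auto simp: P_def cls_def)
  show "connected_edge_set (cls j)"
    unfolding e(2)
  proof
    show "finite {f \<in> E. \<phi> f = \<phi> e}" using finE by simp
    show "card f = 2" if "f \<in> {f \<in> E. \<phi> f = \<phi> e}" for f using that edge(2) by simp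
    show "{f \<in> E. \<phi> f = \<phi> e} \<noteq> {}" using e(1) by auto
  qed (rule connected_class[OF e(1)])
qed

lemma Vs_subset: "Vs j \<subseteq> V"
  using edge(1) by (auto simp: Vs_def cls_def)

lemma finite_Vs: "finite (Vs j)"
  using finite_subset[OF Vs_subset finV] .

lemma cls_P: "e \<in> cls j \<Longrightarrow> j \<in> P"
  by (auto simp: cls_def P_def)

lemma reach_cls: "(u, v) \<in> reach (cls j) \<Longrightarrow> u \<noteq> v \<Longrightarrow> u \<in> Vs j \<and> v \<in> Vs j \<and> j \<in> P"
  using reach_Union[of u v "cls j"] cls_P by (auto simp: Vs_def)

lemma two_ways_cases:
  assumes "u \<in> V" "v \<in> V" "u \<noteq> v"
  obtains j where "tied (cls j) u v"
  | i j where "i \<noteq> j" "(u, v) \<in> reach (cls i)" "(u, v) \<in> reach (cls j)"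
  using two_ways[OF assms] unfolding cls_def[symmetric] by auto

lemma trivial_class:
  assumes "card (Vs j) < 3" "u \<in> Vs j" "v \<in> Vs j" "u \<noteq> v"
  shows "cls j = {{u, v}}"
proof -
  have "card {u, v} \<le> card (Vs j)" using assms(2,3) finite_Vs by (intro card_mono) auto
  then have Vs: "Vs j = {u, v}" using assms finite_Vs by (intro card_subset_eq[symmetric]) auto
  have "e = {u, v}" if "e \<in> cls j" for e
  proof (rule card_subset_eq)
    show "e \<subseteq> {u, v}" using that Vs by (auto simp: Vs_def)
    show "card e = card {u, v}" using that edge(2) assms(4) by (auto simp: cls_def)
  qed simp
  moreover have "cls j \<noteq> {}" using assms(2) by (auto simp: Vs_def)
  ultimately show ?thesis by blast
qed

lemma tied_block:
  assumes "tied (cls j) u v" "u \<noteq> v"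
  obtains X where "X \<in> blocks (cls j)" "u \<in> X" "v \<in> X" "2 \<le> card X" "j \<in> P" "3 \<le> card (Vs j)"
proof -
  have j: "u \<in> Vs j" "v \<in> Vs j" "j \<in> P" using reach_cls[OF tied_reach] assms by auto
  interpret connected_edge_set "cls j" by (rule connected_edge_set_cls[OF j(3)])
  define X where "X = {w. tied (cls j) u w}"
  have X: "X \<in> blocks (cls j)" "u \<in> X" "v \<in> X" using block_of[of u] j assms by (auto simp: X_def Vs_def)
  have "card {u, v} \<le> card X" using X finite_block by (intro card_mono) auto
  then have c: "2 \<le> card X" using assms(2) by simp
  have "3 \<le> card (Vs j)"
  proof (rule ccontr)
    assume "\<not> ?thesis"
    then have "cls j = {{u, v}}" using trivial_class[of j u v] j assms by auto
    then have "card (inside (cls j) X) \<le> 1"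
      using card_mono[of "{{u, v}}" "inside (cls j) X"] by (auto simp: inside_def)
    then show False using card_block_le'[OF X(1) c] c by simp
  qed
  then show ?thesis using that X c j by blast
qed

text \<open>Truncated subtraction is intended: a colour class enters the budget only after its weight
  exceeds 2, and in total it contributes at most its number of edges minus one.\<close>

definition budget :: "'a set \<Rightarrow> nat" where
  "budget B = 1 + (\<Sum>j\<in>P. weight (cls j) B - 2)"

text \<open>A single vertex would be affordable with no edges at all. Two vertices are what makes a
  class containing a maximal \<open>B\<close> reach weight 2, the point from which the budget counts
  every further unit.\<close>

definition affordable :: "'a set \<Rightarrow> bool" where
  "affordable B \<longleftrightarrow> B \<subseteq> V \<and> 2 \<le> card B \<and> (\<exists>D\<subseteq>E. conn2 B D \<and> \<Union>D \<subseteq> B \<and> card D \<le> budget B)"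

lemma affordableI:
  "B \<subseteq> V \<Longrightarrow> 2 \<le> card B \<Longrightarrow> D \<subseteq> E \<Longrightarrow> conn2 B D \<Longrightarrow> \<Union>D \<subseteq> B \<Longrightarrow> card D \<le> budget B \<Longrightarrow> affordable B"
  by (auto simp: affordable_def)

lemma weight_cls_mono: "B \<subseteq> B' \<Longrightarrow> j \<in> P \<Longrightarrow> weight (cls j) B \<le> weight (cls j) B'"
  using connected_edge_set.weight_mono[OF connected_edge_set_cls] .

lemma budget_ge: "j \<in> P \<Longrightarrow> 1 + (weight (cls j) B - 2) \<le> budget B"
  using member_le_sum[of j P "\<lambda>j. weight (cls j) B - 2"] finP by (simp add: budget_def)

lemma budget_step:
  assumes "g \<in> P" "2 \<le> weight (cls g) B" "weight (cls g) B + d \<le> weight (cls g) B'" "B \<subseteq> B'"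
  shows "budget B + d \<le> budget B'"
proof -
  have "(\<Sum>j\<in>P - {g}. weight (cls j) B - 2) \<le> (\<Sum>j\<in>P - {g}. weight (cls j) B' - 2)"
    using weight_cls_mono[OF assms(4)] by (intro sum_mono diff_le_mono) auto
  then show ?thesis using assms(2,3) unfolding budget_def sum.remove[OF finP assms(1)] by linarith
qed

text \<open>The block alone has weight one more than its number of edges; subtracting 2 and adding
  the initial 1 of the budget leaves exactly these edges.\<close>

lemma affordable_block:
  assumes "j \<in> P" "X \<in> blocks (cls j)" "2 \<le> card X"
  shows "affordable X"
proof -
  interpret connected_edge_set "cls j" by (rule connected_edge_set_cls[OF assms(1)])
  have "1 + card (inside (cls j) X) \<le> weight (cls j) X"
    using weight_insert_block[OF assms(2), of "{}"] block_nonempty[OF assms(2)] by simp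
  then have "card (inside (cls j) X) \<le> budget X" using budget_ge[OF assms(1), of X] by linarith
  moreover have "X \<subseteq> V" using block_subset[OF assms(2)] Vs_subset[of j] by (auto simp: Vs_def)
  moreover have "inside (cls j) X \<subseteq> E" "\<Union>(inside (cls j) X) \<subseteq> X" by (auto simp: inside_def cls_def)
  ultimately show ?thesis using conn2_block[OF assms(2)] assms(3) by (auto simp: affordable_def)
qed

lemma obtain_maximal_affordable:
  assumes "affordable B"
  obtains B' where "affordable B'" "\<And>C. affordable C \<Longrightarrow> card C \<le> card B'"
proof -
  have "\<And>C. affordable C \<Longrightarrow> card C < Suc (card V)"
    using finV by (auto simp: affordable_def less_Suc_eq_le intro: card_mono)
  then show ?thesis using ex_has_greatest_nat[of affordable B card "Suc (card V)"] assms that by metis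
qed

section \<open>Consequences of maximality\<close>

context
  fixes B assumes affordable_B: "affordable B" and max_B: "\<And>C. affordable C \<Longrightarrow> card C \<le> card B"
begin

lemma B_sub: "B \<subseteq> V" "2 \<le> card B" "finite B" "B \<noteq> {}"
  using affordable_B finV finite_subset by (auto simp: affordable_def)

lemma not_affordable_larger: "B \<subset> C \<Longrightarrow> \<not> affordable C"
  using max_B psubset_card_mono[of C B] finV by (auto simp: affordable_def dest: finite_subset leD)

text \<open>Either \<open>B\<close> meets two blocks, or it is a nontrivial block and its edges
  count, or it is a proper part of a block, which would itself be affordable and larger.\<close>

lemma weight_ge_2_if:
  assumes "g \<in> P" "B \<subseteq> Vs g"
  shows "2 \<le> weight (cls g) B"
proof -
  interpret connected_edge_set "cls g" by (rule connected_edge_set_cls[OF assms(1)])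
  obtain x where x: "x \<in> B" using B_sub by auto
  define X where "X = {v. tied (cls g) x v}"
  have X: "X \<in> blocks (cls g)" "x \<in> X" using block_of[of x] x assms by (auto simp: X_def Vs_def)
  consider "B = X" | "B \<subset> X" | y where "y \<in> B" "y \<notin> X" by blast
  then show ?thesis
  proof cases
    case 1
    have "card (inside (cls g) X) + 1 \<le> weight (cls g) X"
      using weight_insert_block[OF X(1), of "{}"] X(2) by (cases "X = {}") auto
    then show ?thesis using card_block_le'[OF X(1)] B_sub 1 by simp
  next
    case 2
    then have "2 \<le> card X" using B_sub card_mono[of X B] finite_block[OF X(1)] by auto
    then show ?thesis using affordable_block[OF assms(1) X(1)] not_affordable_larger[OF 2] by simp
  next
    case 3
    define Y where "Y = {v. tied (cls g) y v}"
    have Y: "Y \<in> blocks (cls g)" "y \<in> Y" using block_of[of y] 3 assms by (auto simp: Y_def Vs_def)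
    show ?thesis by (rule weight_ge_2[OF X(1) Y(1)]) (use X Y x 3 in auto)
  qed
qed

text \<open>Otherwise the whole block of \<^term>\<open>v\<close> can be glued to \<^term>\<open>B\<close> at \<^term>\<open>u\<close>, paid for by its own edges.\<close>

lemma max_not_tied:
  assumes "v \<notin> B" "g \<in> P" "B \<subseteq> Vs g" "u \<in> B"
  shows "\<not> tied (cls g) u v"
proof
  assume tied: "tied (cls g) u v"
  interpret connected_edge_set "cls g" by (rule connected_edge_set_cls[OF assms(2)])
  define X where "X = {v. tied (cls g) u v}"
  have X: "X \<in> blocks (cls g)" "u \<in> X" "v \<in> X" using block_of[of u] tied assms by (auto simp: X_def Vs_def)
  obtain D where D: "D \<subseteq> E" "conn2 B D" "\<Union>D \<subseteq> B" "card D \<le> budget B" using affordable_B by (auto simp: affordable_def)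
  have nsub: "\<not> X \<subseteq> B" using X assms(1) by blast
  let ?D = "D \<union> inside (cls g) X"
  have "conn2 (B \<union> X) ?D"
  proof (rule conn2_extend[OF D(2)])
    fix w e assume "w \<in> B \<union> X" "w \<notin> B"
    then have "(w, u) \<in> reach (inside (cls g) X - {e})"
      using conn2_reach[OF conn2_block[OF X(1)], of w u] X(2) by auto
    then have "(w, u) \<in> reach (?D - {e})" by (rule reach_mono) auto
    then show "\<exists>b\<in>B. (w, b) \<in> reach (?D - {e})" using assms(4) by auto
  qed auto
  moreover have "card ?D \<le> budget (B \<union> X)"
  proof -
    have "weight (cls g) B + card (inside (cls g) X) \<le> weight (cls g) (B \<union> X)"
      using weight_insert_block[OF X(1) nsub] by linarith
    then have "budget B + card (inside (cls g) X) \<le> budget (B \<union> X)"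
      by (intro budget_step[OF assms(2) weight_ge_2_if[OF assms(2,3)]]) auto
    then show ?thesis using card_Un_le[of D "inside (cls g) X"] D(4) by linarith
  qed
  moreover have "B \<union> X \<subseteq> V" using B_sub block_subset[OF X(1)] Vs_subset[of g] by (auto simp: Vs_def)
  moreover have "?D \<subseteq> E" "\<Union>?D \<subseteq> B \<union> X" using D by (auto simp: inside_def cls_def)
  moreover have "2 \<le> card (B \<union> X)"
    using B_sub card_mono[of "B \<union> X" B] finite_block[OF X(1)] by auto
  ultimately have "affordable (B \<union> X)" using affordableI by metis
  moreover have "B \<subset> B \<union> X" using X assms(1) by auto
  ultimately show False using not_affordable_larger by metis
qed

text \<open>Otherwise an edge \<open>ab\<close> of the subgraph spanning \<^term>\<open>B\<close> is replaced by the path \<open>a v b\<close>, so that adding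
  \<^term>\<open>v\<close> together with its block costs only one edge more than the block has.\<close>

lemma max_not_adjacent:
  assumes "v \<notin> B" "g \<in> P" "B \<subseteq> Vs g" "v \<in> Vs g"
  shows "\<exists>u\<in>B. {u, v} \<notin> E"
proof (rule ccontr)
  assume "\<not> ?thesis"
  then have adj: "{v, u} \<in> E" if "u \<in> B" for u using that by (auto simp: insert_commute)
  interpret connected_edge_set "cls g" by (rule connected_edge_set_cls[OF assms(2)])
  define X where "X = {w. tied (cls g) v w}"
  have X: "X \<in> blocks (cls g)" "v \<in> X" using block_of[of v] assms by (auto simp: X_def Vs_def)
  have XB: "X \<inter> B = {}"
  proof (rule equals0I)
    fix u assume "u \<in> X \<inter> B"
    then show False using max_not_tied[OF assms(1-3), of u] tied_sym[of "cls g" v u] by (auto simp: X_def)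
  qed
  obtain D where D: "D \<subseteq> E" "conn2 B D" "\<Union>D \<subseteq> B" "card D \<le> budget B" using affordable_B by (auto simp: affordable_def)
  obtain a where a: "a \<in> B" using B_sub by auto
  obtain c where c: "c \<in> B" "c \<noteq> a" using B_sub(2) a by (metis card_2_iff' card_le_Suc0_iff_eq B_sub(3) not_less_eq_eq numeral_2_eq_2)
  have "\<exists>x\<in>{a}. \<exists>y. y \<notin> {a} \<and> {x, y} \<in> D - {{}}"
    by (rule reach_cross[OF conn2_reach[OF D(2) a c(1)]]) (use c(2) in auto)
  then obtain b where b: "{a, b} \<in> D" "a \<noteq> b" by auto
  have bB: "b \<in> B" using b D(3) by auto
  define D1 where "D1 = insert {v, a} (insert {v, b} (D - {{a, b}}))"
  have nsub: "\<not> X \<subseteq> B" using X assms(1) by blast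
  let ?D = "D1 \<union> inside (cls g) X"
  have "conn2 (B \<union> X) ?D"
  proof (rule conn2_extend)
    show "conn2 (insert v B) D1" unfolding D1_def by (rule conn2_subdivide[OF D(2) a bB b(2) D(3) assms(1)])
    fix w e assume "w \<in> B \<union> X" "w \<notin> insert v B"
    then have "(w, v) \<in> reach (inside (cls g) X - {e})"
      using conn2_reach[OF conn2_block[OF X(1)], of w v] X(2) by auto
    then have "(w, v) \<in> reach (?D - {e})" by (rule reach_mono) auto
    then show "\<exists>b\<in>insert v B. (w, b) \<in> reach (?D - {e})" by auto
  qed auto
  moreover have "card ?D \<le> budget (B \<union> X)"
  proof -
    have "weight (cls g) B + (card (inside (cls g) X) + 1) \<le> weight (cls g) (B \<union> X)"
      using weight_insert_block[OF X(1) nsub] XB by simp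
    then have "budget B + (card (inside (cls g) X) + 1) \<le> budget (B \<union> X)"
      by (intro budget_step[OF assms(2) weight_ge_2_if[OF assms(2,3)]]) auto
    moreover have "card D1 \<le> card D + 1"
    proof -
      have "finite D" using D(1) finE finite_subset by metis
      then have "card D1 \<le> Suc (Suc (card (D - {{a, b}})))"
        unfolding D1_def by (simp add: card_insert_if)
      then show ?thesis using b(1) \<open>finite D\<close> card_Suc_Diff1[of D "{a, b}"] by simp
    qed
    ultimately show ?thesis using card_Un_le[of D1 "inside (cls g) X"] D(4) by linarith
  qed
  moreover have "B \<union> X \<subseteq> V" using B_sub block_subset[OF X(1)] Vs_subset[of g] by (auto simp: Vs_def)
  moreover have "?D \<subseteq> E" "\<Union>?D \<subseteq> B \<union> X" using D adj[OF a] adj[OF bB] a bB X(2) by (auto simp: inside_def cls_def D1_def)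
  moreover have "2 \<le> card (B \<union> X)"
    using B_sub card_mono[of "B \<union> X" B] finite_block[OF X(1)] by auto
  ultimately have "affordable (B \<union> X)" using affordableI by metis
  moreover have "B \<subset> B \<union> X" using X assms(1) by auto
  ultimately show False using not_affordable_larger by metis
qed

end

end

section \<open>Counting outside a maximal affordable set\<close>

context coloured
begin

text \<open>Every vertex outside \<^term>\<open>B\<close> lies in at least two nontrivial classes meeting \<^term>\<open>B\<close>. A class in
  \<open>Bad\<close> (a tree meeting \<^term>\<open>B\<close> once) yields one unit less than its number of new vertices; this loss
  is charged to a vertex \<open>w j\<close> joined to \<^term>\<open>B\<close> by an edge of the class, which then lies in one more class.\<close>

lemma maximal_affordable_count:
  assumes B: "affordable B" and max: "\<And>C. affordable C \<Longrightarrow> card C \<le> card B"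
  shows "budget B + 2 * card (V - B) \<le> budget V"
proof -
  note Bsub = B_sub[OF B max]
  define N where "N = {j \<in> P. 3 \<le> card (Vs j) \<and> Vs j \<inter> B \<noteq> {}}"
  define Bad where "Bad = {j \<in> N. card (Vs j \<inter> B) = 1 \<and> (\<forall>X\<in>blocks (cls j). \<not> 2 \<le> card X)}"
  have fin: "finite N" "finite Bad" using finP by (auto simp: N_def Bad_def)
  \<comment> \<open>If the weight at \<open>B\<close> is at least 2, nothing is truncated and
    \<open>weight_gain\<close> applies. If not, the first term vanishes and the total weight must
    exceed the number of new vertices by 2: two vertices in \<open>B\<close> suffice, or one vertex
    in \<open>B\<close> together with a nontrivial block; the remaining classes are
    \<open>Bad\<close>.\<close>
  have gain: "(weight (cls j) B - 2) + (if j \<in> N then card (Vs j - B) else 0)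
      \<le> (weight (cls j) V - 2) + (if j \<in> Bad then 1 else 0)" if j: "j \<in> P" for j
  proof -
    interpret connected_edge_set "cls j" by (rule connected_edge_set_cls[OF j])
    have sub: "\<Union>(cls j) \<subseteq> V" using Vs_subset[of j] by (simp add: Vs_def)
    have mono: "weight (cls j) B \<le> weight (cls j) V" by (rule weight_mono[OF Bsub(1)])
    show ?thesis
    proof (cases "2 \<le> weight (cls j) B \<or> j \<notin> N")
      case True
      then show ?thesis using weight_gain[OF sub, of B] mono by (auto simp: Vs_def)
    next
      case False
      have c: "card (Vs j - B) + card (Vs j \<inter> B) = card (Vs j)"
        using card_Int_Diff[of "Vs j" B] finite_Vs by simp
      have "0 < card (Vs j \<inter> B)" using False finite_Vs by (auto simp: N_def card_gt_0_iff)
      moreover have "card (Vs j) \<le> weight (cls j) V" using weight_top_ge[OF sub] by (simp add: Vs_def)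
      moreover have "card (Vs j) + 1 \<le> weight (cls j) V" if "card (Vs j \<inter> B) = 1" "j \<notin> Bad"
        using weight_top_ge'[OF sub] that False by (auto simp: Vs_def Bad_def)
      ultimately show ?thesis using False c by (cases "card (Vs j \<inter> B) = 1"; cases "j \<in> Bad") simp_all
    qed
  qed
  have "(\<Sum>j\<in>P. weight (cls j) B - 2) + (\<Sum>j\<in>N. card (Vs j - B))
      \<le> (\<Sum>j\<in>P. weight (cls j) V - 2) + card Bad"
  proof -
    have "(\<Sum>j\<in>P. if j \<in> N then card (Vs j - B) else 0) = (\<Sum>j\<in>N. card (Vs j - B))"
      using finP by (simp add: sum.If_cases Int_absorb1 N_def) (auto intro!: sum.cong)
    moreover have "(\<Sum>j\<in>P. if j \<in> Bad then 1 else 0) = card Bad"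
    proof -
      have "P \<inter> Bad = Bad" by (auto simp: Bad_def N_def)
      then show ?thesis using finP by (simp add: sum.If_cases)
    qed
    moreover have "(\<Sum>j\<in>P. (weight (cls j) B - 2) + (if j \<in> N then card (Vs j - B) else 0))
      \<le> (\<Sum>j\<in>P. (weight (cls j) V - 2) + (if j \<in> Bad then 1 else 0))"
      by (rule sum_mono[OF gain])
    ultimately show ?thesis by (simp add: sum.distrib)
  qed
  moreover have "(\<Sum>j\<in>N. card (Vs j - B)) = (\<Sum>v\<in>V - B. card {j \<in> N. v \<in> Vs j})"
  proof -
    have "Vs j - B = {v \<in> V - B. v \<in> Vs j}" for j using Vs_subset[of j] by auto
    then show ?thesis using sum_card_Collect_swap[of N "V - B" "\<lambda>j v. v \<in> Vs j"] fin finV by simp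
  qed
  moreover have "\<exists>w. w \<in> V - B \<and> (\<exists>u\<in>B. {u, w} \<in> cls j)" if "j \<in> Bad" for j
  proof -
    have j: "j \<in> P" "3 \<le> card (Vs j)" "card (Vs j \<inter> B) = 1" "Vs j \<inter> B \<noteq> {}"
      using that by (auto simp: Bad_def N_def)
    interpret connected_edge_set "cls j" by (rule connected_edge_set_cls[OF j(1)])
    obtain x where x: "x \<in> Vs j" "x \<in> B" using j(4) by auto
    have "\<not> Vs j \<subseteq> B" using j by (auto simp: Int_absorb2)
    then obtain y where y: "y \<in> Vs j" "y \<notin> B" by auto
    have "(x, y) \<in> reach (cls j)" using connected x y by (simp add: Vs_def)
    from reach_cross[OF this x(2) y(2)] obtain u w where uw: "u \<in> B" "w \<notin> B" "{u, w} \<in> cls j" by auto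
    then have "w \<in> Vs j" by (auto simp: Vs_def)
    then show ?thesis using uw Vs_subset[of j] by auto
  qed
  then obtain w where w: "\<And>j. j \<in> Bad \<Longrightarrow> w j \<in> V - B" "\<And>j. j \<in> Bad \<Longrightarrow> \<exists>u\<in>B. {u, w j} \<in> cls j"
    by metis
  have "card Bad = (\<Sum>v\<in>V - B. card {j \<in> Bad. w j = v})"
  proof -
    have "(\<Sum>j\<in>Bad. card {v \<in> V - B. w j = v}) = (\<Sum>j\<in>Bad. 1)"
    proof (rule sum.cong)
      fix j assume "j \<in> Bad"
      then have "{v \<in> V - B. w j = v} = {w j}" using w(1) by auto
      then show "card {v \<in> V - B. w j = v} = 1" by simp
    qed simp
    then show ?thesis using sum_card_Collect_swap[of Bad "V - B" "\<lambda>j v. w j = v"] fin finV by simp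
  qed
  moreover have "(\<Sum>v\<in>V - B. 2 + card {j \<in> Bad. w j = v}) \<le> (\<Sum>v\<in>V - B. card {j \<in> N. v \<in> Vs j})"
  proof (rule sum_mono, rule ccontr)
    fix v assume v: "v \<in> V - B"
    define M where "M = {j \<in> N. v \<in> Vs j}"
    define Q where "Q = {j \<in> Bad. w j = v}"
    assume "\<not> 2 + card {j \<in> Bad. w j = v} \<le> card {j \<in> N. v \<in> Vs j}"
    then have MQ: "card M < 2 + card Q" by (simp add: M_def Q_def)
    have QM: "Q \<subseteq> M"
    proof
      fix j assume j: "j \<in> Q"
      then have "v \<in> Vs j" using w(2)[of j] by (auto simp: Q_def Vs_def)
      then show "j \<in> M" using j by (auto simp: Q_def M_def Bad_def)
    qed
    \<comment> \<open>If the count fails at \<open>v\<close>, then apart from the classes charged to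
      \<open>v\<close> at most one nontrivial class through \<open>v\<close> meets \<open>B\<close>.
      Such a class would have to serve all of \<open>B\<close>, against maximality.\<close>
    have "card (M - Q) < 2"
      using MQ QM fin by (subst card_Diff_subset) (auto simp: M_def Q_def)
    moreover have finMQ: "finite (M - Q)" using fin by (simp add: M_def)
    ultimately have uniq: "i = j" if "i \<in> M - Q" "j \<in> M - Q" for i j
      using that card_le_Suc0_iff_eq[OF finMQ] by simp
    have in_M: "j \<in> M" if "j \<in> P" "3 \<le> card (Vs j)" "u \<in> B" "u \<in> Vs j" "v \<in> Vs j" for j u
      using that by (auto simp: M_def N_def)
    have tied_MQ: "j \<in> M - Q" if "tied (cls j) u v" "u \<in> B" for j u
    proof -
      note t = that
      have "u \<noteq> v" using that v by auto
      then obtain X where X: "X \<in> blocks (cls j)" "2 \<le> card X" "j \<in> P" "3 \<le> card (Vs j)"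
        using tied_block[OF t(1)] by metis
      moreover have "u \<in> Vs j" "v \<in> Vs j" using reach_cls[OF tied_reach[OF that(1)] \<open>u \<noteq> v\<close>] by auto
      ultimately show ?thesis using in_M[of j u] that(2) by (auto simp: Q_def Bad_def)
    qed
    \<comment> \<open>A trivial class is just the edge \<open>uv\<close>. A class in
      \<open>Q\<close> meets \<open>B\<close> only once, so the end in \<open>B\<close> of its
      charged edge can only be \<open>u\<close>. All connections outside \<open>M - Q\<close> thus
      contain the same edge.\<close>
    have direct: "j \<in> M - Q \<or> {u, v} \<in> cls j" if "(u, v) \<in> reach (cls j)" "u \<in> B" for j u
    proof -
      have uv: "u \<noteq> v" using that v by auto
      then have j: "u \<in> Vs j" "v \<in> Vs j" "j \<in> P" using reach_cls[OF that(1)] by auto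
      have inM: "\<not> card (Vs j) < 3 \<Longrightarrow> j \<in> M" using in_M[OF j(3) _ that(2) j(1,2)] by simp
      consider "card (Vs j) < 3" | "j \<in> Q" | "j \<in> M - Q" using inM by fastforce
      then show ?thesis
      proof cases
        case 1 then show ?thesis using trivial_class[of j u v] j uv by auto
      next
        case 2
        then obtain u' where u': "u' \<in> B" "{u', v} \<in> cls j" using w(2)[of j] by (auto simp: Q_def)
        have "card (Vs j \<inter> B) = 1" using 2 by (auto simp: Q_def Bad_def)
        then obtain z where "Vs j \<inter> B = {z}" by (auto simp: card_1_singleton_iff)
        moreover have "u' \<in> Vs j" using u' by (auto simp: Vs_def)
        ultimately have "u \<in> {z}" "u' \<in> {z}" using u'(1) j(1) that(2) by (metis IntI)+
        then have "u = u'" by simp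
        then show ?thesis using u' by simp
      qed auto
    qed
    \<comment> \<open>The edge \<open>uv\<close> has only one colour, so of two connecting classes
      at most one contains it; the other lies in \<open>M - Q\<close>. Since \<open>M - Q\<close>
      has at most one element, the first one does contain the edge.\<close>
    have main: "(\<exists>g\<in>M - Q. u \<in> Vs g) \<and> ({u, v} \<in> E \<or> (\<exists>g\<in>M - Q. tied (cls g) u v))" if u: "u \<in> B" for u
    proof -
      have uv: "u \<in> V" "v \<in> V" "u \<noteq> v" using u v Bsub by auto
      show ?thesis
      proof (rule two_ways_cases[OF uv])
        fix j assume "tied (cls j) u v"
        then show ?thesis using tied_MQ[of j u] u reach_cls[OF tied_reach uv(3)] by auto
      next
        fix i j assume ij: "i \<noteq> j" "(u, v) \<in> reach (cls i)" "(u, v) \<in> reach (cls j)"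
        have "\<not> ({u, v} \<in> cls i \<and> {u, v} \<in> cls j)" using ij(1) by (auto simp: cls_def)
        moreover have "\<not> (i \<in> M - Q \<and> j \<in> M - Q)" using uniq ij(1) by auto
        moreover have "u \<in> Vs i" "u \<in> Vs j" using reach_cls ij uv(3) by auto
        moreover have "{u, v} \<in> cls i \<or> {u, v} \<in> cls j \<Longrightarrow> {u, v} \<in> E" by (auto simp: cls_def)
        ultimately show ?thesis using direct[OF ij(2) u] direct[OF ij(3) u] by blast
      qed
    qed
    obtain u0 where "u0 \<in> B" using Bsub by auto
    then obtain g where g: "g \<in> M - Q" using main by blast
    then have gP: "g \<in> P" "v \<in> Vs g" by (auto simp: M_def N_def)
    have sub: "B \<subseteq> Vs g"
    proof
      fix u assume "u \<in> B"
      then obtain h where "h \<in> M - Q" "u \<in> Vs h" using main by blast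
      then show "u \<in> Vs g" using uniq[OF g] by auto
    qed
    have vB: "v \<notin> B" using v by simp
    obtain u where u: "u \<in> B" "{u, v} \<notin> E"
      using max_not_adjacent[OF B max vB gP(1) sub gP(2)] by auto
    obtain h where "h \<in> M - Q" "tied (cls h) u v" using main[OF u(1)] u(2) by blast
    then have "tied (cls g) u v" using uniq[OF g] by auto
    then show False using max_not_tied[OF B max vB gP(1) sub u(1)] by simp
  qed
  moreover have "(\<Sum>v\<in>V - B. 2 + card {j \<in> Bad. w j = v})
      = 2 * card (V - B) + (\<Sum>v\<in>V - B. card {j \<in> Bad. w j = v})"
    by (simp only: sum.distrib) simp
  ultimately show ?thesis unfolding budget_def by linarith
qed

section \<open>An initial affordable set\<close>

lemma neighbours_card:
  assumes "x \<in> V"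
  shows "2 \<le> card {y. {x, y} \<in> E}"
proof -
  have fin: "finite {y. {x, y} \<in> E}"
    by (rule finite_subset[OF _ finV]) (use edge(1) in auto)
  obtain z where z: "z \<in> V" "z \<noteq> x"
  proof -
    have "\<not> V \<subseteq> {x}" using card_V card_mono[of "{x}" V] by auto
    then show ?thesis using that by auto
  qed
  have cross: "\<exists>y. y \<noteq> x \<and> {x, y} \<in> E - {e}" for e
  proof -
    have "(x, z) \<in> reach (E - {e})" using conn2_VE assms z by (simp add: conn2_def)
    from reach_cross[OF this, of "{x}"] z show ?thesis by auto
  qed
  obtain y where y: "{x, y} \<in> E" using cross[of "{}"] by auto
  obtain y' where y': "{x, y'} \<in> E" "y' \<noteq> y" using cross[of "{x, y}"] by auto
  have "card {y, y'} \<le> card {y. {x, y} \<in> E}" using y y' fin by (intro card_mono) auto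
  then show ?thesis using y' by simp
qed

text \<open>The endpoint \<open>x\<close> of a longest path has all its neighbours on the path.\<close>

lemma neighbour_cycle:
  obtains x B D where "x \<in> V" "B \<subseteq> V" "x \<in> B" "{y. {x, y} \<in> E} \<subseteq> B" "3 \<le> card B"
    "D \<subseteq> E" "\<Union>D \<subseteq> B" "conn2 B D" "card D \<le> card B"
proof -
  define pth where "pth p \<longleftrightarrow> p \<noteq> [] \<and> distinct p \<and> set p \<subseteq> V \<and> path_edges p \<subseteq> E" for p
  obtain v0 where "v0 \<in> V" using card_V by fastforce
  then have "pth [v0]" by (simp add: pth_def)
  moreover have "\<And>p. pth p \<Longrightarrow> length p < Suc (card V)"
    using finV card_mono by (fastforce simp: pth_def less_Suc_eq_le distinct_card[symmetric])
  ultimately obtain p where p: "pth p" "\<And>q. pth q \<Longrightarrow> length q \<le> length p"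
    using ex_has_greatest_nat[of pth "[v0]" length "Suc (card V)"] by metis
  define x where "x = p ! 0"
  have p': "p \<noteq> []" "distinct p" "set p \<subseteq> V" "path_edges p \<subseteq> E" using p(1) by (auto simp: pth_def)
  have xV: "x \<in> V" using p' by (cases p) (auto simp: x_def)
  define A where "A = {y. {x, y} \<in> E}"
  have A_p: "A \<subseteq> set p"
  proof
    fix y assume y: "y \<in> A"
    show "y \<in> set p"
    proof (rule ccontr)
      assume "y \<notin> set p"
      moreover have "y \<in> V" using y edge(1) by (auto simp: A_def)
      ultimately have "pth (y # p)"
        using p' y by (cases p) (auto simp: pth_def x_def A_def insert_commute)
      then show False using p(2)[of "y # p"] by simp
    qed
  qed
  have A2: "2 \<le> card A" using neighbours_card[OF xV] by (simp add: A_def)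
  have xA: "x \<notin> A" using edge(2)[of "{x, x}"] by (auto simp: A_def)
  define I where "I = {i. i < length p \<and> p ! i \<in> A}"
  have finI: "finite I" by (simp add: I_def)
  have "I \<noteq> {}"
  proof -
    obtain y where "y \<in> A" using A2 by fastforce
    then show ?thesis using A_p by (force simp: I_def in_set_conv_nth)
  qed
  \<comment> \<open>The farthest neighbour of \<open>x\<close> along the path: closing the path
    there encloses all other neighbours.\<close>
  define m where "m = Max I"
  have m: "m < length p" "p ! m \<in> A" using Max_in[OF finI \<open>I \<noteq> {}\<close>] by (auto simp: I_def m_def)
  \<comment> \<open>Since \<open>x\<close> is \<open>p ! 0\<close>, the default value beyond
    \<open>m\<close> closes the cycle.\<close>
  define s where "s t = (if t \<le> m then p ! t else x)" for t
  have B_img: "s ` {..<Suc m} = (!) p ` {..m}" by (auto simp: s_def)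
  define B where "B = s ` {..<Suc m}"
  have inj: "inj_on s {..<Suc m}"
    using p'(2) m(1) by (auto simp: inj_on_def s_def nth_eq_iff_index_eq)
  then have cB: "card B = Suc m" using card_image by (fastforce simp: B_def)
  have AB: "insert x A \<subseteq> B"
  proof
    fix y assume y: "y \<in> insert x A"
    then have "y \<in> set p" using A_p p' by (auto simp: x_def)
    then obtain i where i: "i < length p" "y = p ! i" by (auto simp: in_set_conv_nth)
    have "i \<le> m" if "y \<in> A" using that i finI by (auto simp: m_def I_def intro!: Max_ge)
    moreover have "x \<in> (!) p ` {..m}" unfolding x_def by (rule imageI) simp
    ultimately show "y \<in> B" using y i unfolding B_def B_img by (cases "y = x") auto
  qed
  have finB: "finite B" by (simp add: B_def)
  have c3: "3 \<le> card B"
    using card_mono[OF finB AB] A2 xA finite_subset[OF A_p] by simp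
  define D where "D = (\<lambda>t. {s t, s (Suc t)}) ` {..<Suc m}"
  have "{s t, s (Suc t)} \<in> E" if "t < Suc m" for t
  proof (cases "t = m")
    case True then show ?thesis using m(2) by (auto simp: s_def A_def insert_commute)
  next
    case False
    then have "Suc t < length p" "t < m" using that m by auto
    then show ?thesis using path_edges_nth[of t p] p'(4) by (auto simp: s_def)
  qed
  then have DE: "D \<subseteq> E" by (auto simp: D_def)
  have conn: "conn2 B D"
    unfolding B_def by (rule conn2_cycle[OF inj]) (use c3 cB in \<open>auto simp: s_def x_def D_def\<close>)
  have "s (Suc t) \<in> B" if "t < Suc m" for t
    using that AB by (cases "t = m") (auto simp: B_def s_def)
  then have "\<Union>D \<subseteq> B" by (auto simp: D_def B_def)
  moreover have "card D \<le> card B" unfolding D_def cB using card_image_le[of "{..<Suc m}"] by fastforce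
  moreover have "B \<subseteq> V"
    unfolding B_def B_img using p'(3) m(1) by (force intro: nth_mem)
  ultimately show ?thesis using that[of x B D] xV AB c3 DE conn by (auto simp: A_def)
qed

text \<open>If no class contains a cycle, the cycle through all neighbours of \<open>x\<close> is affordable: each of its
  other vertices lies in two nontrivial classes with \<open>x\<close>, or in one if it is joined to \<open>x\<close> by a class with a single edge.\<close>

lemma affordable_exists: "\<exists>B. affordable B"
proof (cases "\<exists>j\<in>P. \<exists>X\<in>blocks (cls j). 2 \<le> card X")
  case True then show ?thesis using affordable_block by blast
next
  case False
  obtain x B D where xB: "x \<in> V" "B \<subseteq> V" "x \<in> B" "{y. {x, y} \<in> E} \<subseteq> B" "3 \<le> card B"
    and D: "D \<subseteq> E" "\<Union>D \<subseteq> B" "conn2 B D" "card D \<le> card B" by (rule neighbour_cycle)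
  have finB: "finite B" using xB(2) finV finite_subset by metis
  have not_tied: "\<not> tied (cls j) u v" if "u \<noteq> v" for j u v
    using tied_block[of j u v] that False by metis
  define Nx where "Nx = {j \<in> P. x \<in> Vs j \<and> 3 \<le> card (Vs j)}"
  define A where "A = {y. {x, y} \<in> E}"
  define T where "T = {v \<in> A. \<phi> {x, v} \<notin> Nx}"
  have finN: "finite Nx" using finP by (simp add: Nx_def)
  have AB: "A \<subseteq> B - {x}" using xB(4) edge(2)[of "{x, x}"] by (auto simp: A_def)
  then have finA: "finite A" using finB finite_subset by blast
  \<comment> \<open>A class in \<open>Nx\<close> is connected and contains more than
    \<open>x\<close>, hence owns an edge at \<open>x\<close>, whose other end is not in
    \<open>T\<close>. Different classes use different neighbours.\<close>
  have NA: "card Nx + card T \<le> card A"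
  proof -
    have "Nx \<subseteq> (\<lambda>y. \<phi> {x, y}) ` (A - T)"
    proof
      fix j assume j: "j \<in> Nx"
      interpret connected_edge_set "cls j" by (rule connected_edge_set_cls) (use j in \<open>simp add: Nx_def\<close>)
      have "\<not> Vs j \<subseteq> {x}" using j card_mono[of "{x}" "Vs j"] by (auto simp: Nx_def)
      then obtain z where z: "z \<in> Vs j" "z \<noteq> x" by auto
      have "(x, z) \<in> reach (cls j)" using connected z j by (auto simp: Nx_def Vs_def)
      from reach_cross[OF this, of "{x}"] z obtain y where "{x, y} \<in> cls j" by auto
      then show "j \<in> (\<lambda>y. \<phi> {x, y}) ` (A - T)" using j by (auto simp: cls_def A_def T_def)
    qed
    then have "card Nx \<le> card (A - T)" using finA by (intro surj_card_le) auto
    moreover have "card (A - T) = card A - card T" "card T \<le> card A"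
      using finA by (auto simp: T_def intro!: card_Diff_subset card_mono)
    ultimately show ?thesis by linarith
  qed
  have cA: "card A \<le> card B - 1" using card_mono[OF _ AB] finB xB(3) by simp
  have meet: "card (Vs j \<inter> B) = card {v \<in> B - {x}. v \<in> Vs j} + 1 \<and> 2 \<le> card (Vs j \<inter> B)
      \<and> card (Vs j \<inter> B) \<le> weight (cls j) B" if j: "j \<in> Nx" for j
  proof -
    have jP: "j \<in> P" "x \<in> Vs j" using j by (auto simp: Nx_def)
    interpret connected_edge_set "cls j" by (rule connected_edge_set_cls[OF jP(1)])
    have "card X = 1" if "X \<in> blocks (cls j)" for X
    proof -
      have "\<not> 2 \<le> card X" using False that jP by blast
      moreover have "0 < card X" using block_nonempty[OF that] finite_block[OF that] by (simp add: card_gt_0_iff)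
      ultimately show ?thesis by simp
    qed
    then have "card (Vs j \<inter> B) \<le> weight (cls j) B" using weight_trivial_blocks by (simp add: Vs_def)
    moreover have "Vs j \<inter> B = insert x {v \<in> B - {x}. v \<in> Vs j}" using jP xB(3) by auto
    then have "card (Vs j \<inter> B) = card {v \<in> B - {x}. v \<in> Vs j} + 1" using finB by simp
    moreover have "{v \<in> B - {x}. v \<in> Vs j} \<noteq> {}"
    proof -
      have "\<not> Vs j \<subseteq> {x}" using j card_mono[of "{x}" "Vs j"] by (auto simp: Nx_def)
      then obtain z where z: "z \<in> Vs j" "z \<noteq> x" by auto
      have "(x, z) \<in> reach (cls j)" using connected z j by (auto simp: Nx_def Vs_def)
      from reach_cross[OF this, of "{x}"] z obtain y where y: "{x, y} \<in> cls j" "y \<noteq> x" by auto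
      then have "y \<in> A" "y \<in> Vs j" by (auto simp: cls_def A_def Vs_def)
      then show ?thesis using AB by auto
    qed
    then have "0 < card {v \<in> B - {x}. v \<in> Vs j}" using finB by (simp add: card_gt_0_iff)
    ultimately show ?thesis by simp
  qed
  have "(\<Sum>v\<in>B - {x}. 2) \<le> (\<Sum>v\<in>B - {x}. card {j \<in> Nx. v \<in> Vs j} + (if v \<in> T then 1 else 0))"
  proof (rule sum_mono)
    fix v assume v: "v \<in> B - {x}"
    have fin: "finite {j \<in> Nx. v \<in> Vs j}" using finN by simp
    have xv: "x \<in> V" "v \<in> V" "x \<noteq> v" using v xB by auto
    show "2 \<le> card {j \<in> Nx. v \<in> Vs j} + (if v \<in> T then 1 else 0)"
    proof (rule two_ways_cases[OF xv])
      fix j assume "tied (cls j) x v"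
      then show ?thesis using not_tied xv by blast
    next
      fix i j assume ij: "i \<noteq> j" "(x, v) \<in> reach (cls i)" "(x, v) \<in> reach (cls j)"
      have Vij: "x \<in> Vs i" "v \<in> Vs i" "x \<in> Vs j" "v \<in> Vs j" "i \<in> P" "j \<in> P"
        using reach_cls ij xv(3) by auto
      have triv: "v \<in> T \<and> \<phi> {x, v} = i" if "i \<notin> Nx" "x \<in> Vs i" "v \<in> Vs i" "i \<in> P" for i
      proof -
        have "cls i = {{x, v}}" using trivial_class[of i x v] that xv(3) by (auto simp: Nx_def)
        then have "{x, v} \<in> cls i" by simp
        then show ?thesis using that(1) by (auto simp: cls_def T_def A_def)
      qed
      consider "i \<in> Nx" "j \<in> Nx" | "i \<in> Nx" "v \<in> T" | "j \<in> Nx" "v \<in> T"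
        using triv[of i] triv[of j] Vij ij(1) by blast
      then show ?thesis
      proof cases
        case 1
        then have "card {i, j} \<le> card {j \<in> Nx. v \<in> Vs j}" using fin Vij by (intro card_mono) auto
        then show ?thesis using ij(1) by simp
      next
        case 2
        then have "i \<in> {j \<in> Nx. v \<in> Vs j}" using Vij by simp
        then have "0 < card {j \<in> Nx. v \<in> Vs j}" using fin card_gt_0_iff by blast
        then show ?thesis using 2 by simp
      next
        case 3
        then have "j \<in> {j \<in> Nx. v \<in> Vs j}" using Vij by simp
        then have "0 < card {j \<in> Nx. v \<in> Vs j}" using fin card_gt_0_iff by blast
        then show ?thesis using 3 by simp
      qed
    qed
  qed
  moreover have "(\<Sum>v\<in>B - {x}. if v \<in> T then 1 else 0) = card T"
  proof -
    have "(B - {x}) \<inter> T = T" using AB by (auto simp: T_def)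
    then show ?thesis using finB by (simp add: sum.If_cases)
  qed
  moreover have "(\<Sum>v\<in>B - {x}. card {j \<in> Nx. v \<in> Vs j}) = (\<Sum>j\<in>Nx. card {v \<in> B - {x}. v \<in> Vs j})"
    using sum_card_Collect_swap[of "B - {x}" Nx "\<lambda>v j. v \<in> Vs j"] finB finN by simp
  moreover have "(\<Sum>v\<in>B - {x}. 2) = 2 * (card B - 1)" using finB xB(3) by simp
  ultimately have "2 * (card B - 1) \<le> (\<Sum>j\<in>Nx. card {v \<in> B - {x}. v \<in> Vs j}) + card T"
    by (simp only: sum.distrib)
  moreover have "(\<Sum>j\<in>Nx. card {v \<in> B - {x}. v \<in> Vs j}) \<le> (\<Sum>j\<in>Nx. (weight (cls j) B - 2) + 1)"
    using meet by (intro sum_mono) fastforce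
  moreover have "(\<Sum>j\<in>Nx. (weight (cls j) B - 2) + 1) = (\<Sum>j\<in>Nx. weight (cls j) B - 2) + card Nx"
    by (simp only: sum.distrib) simp
  moreover have "(\<Sum>j\<in>Nx. weight (cls j) B - 2) \<le> (\<Sum>j\<in>P. weight (cls j) B - 2)"
    by (rule sum_mono2[OF finP]) (auto simp: Nx_def)
  \<comment> \<open>Write b for \<open>card B - 1\<close>. The double count gives 2b at most the sum
    of the truncated weights plus \<open>card Nx + card T\<close>, and the latter is at most
    \<open>card A\<close>, hence at most b. The sum is therefore at least b, and the initial 1 of
    the budget pays for the last edge of the cycle.\<close>
  ultimately have "card B \<le> budget B" using NA cA xB(5) unfolding budget_def by linarith
  then have "affordable B" using D xB(2,5) by (intro affordableI[of B D]) auto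
  then show ?thesis by blast
qed

theorem few_colours:
  "\<exists>D\<subseteq>E. conn2 V D \<and> card D + card P \<le> card E + 1"
proof -
  obtain B0 where "affordable B0" using affordable_exists by blast
  then obtain B where B: "affordable B" "\<And>C. affordable C \<Longrightarrow> card C \<le> card B"
    using obtain_maximal_affordable by metis
  note Bsub = B_sub[OF B]
  obtain D where D: "D \<subseteq> E" "conn2 B D" "\<Union>D \<subseteq> B" "card D \<le> budget B" using B(1) by (auto simp: affordable_def)
  have "\<Union>E \<subseteq> V" using edge(1) by auto
  then obtain D' where D': "D' \<subseteq> E" "conn2 V D'" "card D' \<le> card D + 2 * card (V - B)"
    using conn2_spanning_extension[OF finV _ conn2_VE Bsub(1,4) D(1,2) finE] by auto
  have "card D' \<le> budget V" using D'(3) D(4) maximal_affordable_count[OF B] by linarith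
  moreover have "budget V + card P \<le> 1 + card E"
  proof -
    \<comment> \<open>The weight is at most the number of edges plus one, so subtracting 2 and
      adding 1 stays within the class. Below weight 2, nonemptiness of the class covers the
      1.\<close>
    have "(\<Sum>j\<in>P. (weight (cls j) V - 2) + 1) \<le> (\<Sum>j\<in>P. card (cls j))"
    proof (rule sum_mono)
      fix j assume j: "j \<in> P"
      interpret connected_edge_set "cls j" by (rule connected_edge_set_cls[OF j])
      have "weight (cls j) V \<le> card (cls j) + 1" using weight_top_le[of V] Vs_subset[of j] by (simp add: Vs_def)
      moreover have "0 < card (cls j)" using finF nonempty by (simp add: card_gt_0_iff)
      ultimately show "(weight (cls j) V - 2) + 1 \<le> card (cls j)" by linarith
    qed
    moreover have "(\<Sum>j\<in>P. card (cls j)) = card E"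
    proof -
      have "card (\<Union>j\<in>P. cls j) = (\<Sum>j\<in>P. card (cls j))"
        using finE finP by (intro card_UN_disjoint) (auto simp: cls_def)
      moreover have "(\<Union>j\<in>P. cls j) = E" by (auto simp: cls_def P_def)
      ultimately show ?thesis by simp
    qed
    moreover have "(\<Sum>j\<in>P. (weight (cls j) V - 2) + 1) = (\<Sum>j\<in>P. weight (cls j) V - 2) + card P"
      by (simp only: sum.distrib) simp
    ultimately show ?thesis unfolding budget_def by linarith
  qed
  ultimately have "card D' + card P \<le> card E + 1" by linarith
  then show ?thesis using D' by blast
qed

end

section \<open>The case k = 2\<close>

text \<open>A walk in one colour never leaves its component, so all its edges carry the split colour
  of its start. \<open>F\<close> may be smaller than \<open>C\<close>, so that an edge can be
  deleted while components are still taken in the whole colour.\<close>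

lemma reach_component:
  assumes "(u, v) \<in> reach F" "F \<subseteq> C"
    and "\<And>x y. {x, y} \<in> C \<Longrightarrow> \<phi> {x, y} = (a, {z. (x, z) \<in> reach C})"
  shows "(u, v) \<in> reach {f \<in> F. \<phi> f = (a, {z. (u, z) \<in> reach C})}"
  using assms(1)
proof (induction rule: reach_induct)
  case (step x y)
  have "(u, x) \<in> reach C" using step(1) assms(2) by (rule reach_mono)
  then have "{z. (x, z) \<in> reach C} = {z. (u, z) \<in> reach C}"
    using reach_trans[of u x C] reach_trans[of x u C] reach_sym[of u x C] by blast
  then have xy: "{x, y} \<in> {f \<in> F. \<phi> f = (a, {z. (u, z) \<in> reach C})}"
    using assms(2,3) step(2) by auto
  show ?case by (rule reach_trans[OF step(3) reach_edge[OF xy]])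
qed simp

lemma card_colours_le_2:
  fixes G H :: "'a ugraph"
  assumes G: "k_edge_connected 2 G" and H: "minimum_k_edge_connected_spanning_subgraph 2 H G"
    and c: "MC_coloring 2 G c"
  shows "card (c ` edges G) + e_num H \<le> e_num G + 1"
proof -
  have G': "simple_graph G" "2 \<le> card (verts G)" "conn2 (verts G) (edges G)"
    using G k_edge_connected_2_iff[of G] by auto
  define Ec where "Ec a = {f \<in> edges G. c f = a}" for a
  \<comment> \<open>splitting each colour into its connected components can only increase the number of colours\<close>
  define \<phi> where "\<phi> e = (c e, {z. \<exists>x\<in>e. (x, z) \<in> reach (Ec (c e))})" for e
  have \<phi>: "\<phi> {x, y} = (a, {z. (x, z) \<in> reach (Ec a)})" if "{x, y} \<in> Ec a" for x y a
  proof -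
    have "(x, z) \<in> reach (Ec a) \<longleftrightarrow> (y, z) \<in> reach (Ec a)" for z
      using reach_trans reach_sym reach_edge[OF that] by metis
    then show ?thesis using that by (auto simp: \<phi>_def Ec_def)
  qed
  have comp: "(u, v) \<in> reach {f \<in> F. \<phi> f = (a, {z. (u, z) \<in> reach (Ec a)})}"
    if "(u, v) \<in> reach F" "F \<subseteq> Ec a" for u v F a
    using that \<phi> by (rule reach_component)
  interpret coloured "verts G" "edges G" \<phi>
  proof
    fix e x y
    assume e: "e \<in> edges G" and x: "x \<in> \<Union>{f \<in> edges G. \<phi> f = \<phi> e}" and y: "y \<in> \<Union>{f \<in> edges G. \<phi> f = \<phi> e}"
    have *: "\<phi> e = (c e, {z. (x, z) \<in> reach (Ec (c e))})" if "x \<in> \<Union>{f \<in> edges G. \<phi> f = \<phi> e}" for x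
    proof -
      obtain f where f: "f \<in> edges G" "\<phi> f = \<phi> e" "x \<in> f" using \<open>x \<in> \<Union>_\<close> by auto
      then have "card f = 2" using G'(1) by (auto simp: simple_graph_def)
      then obtain w where "f = {x, w}" using f(3) by (auto simp: card_2_iff)
      moreover have "c f = c e" using f(2) by (simp add: \<phi>_def)
      ultimately show ?thesis using \<phi>[of x w "c e"] f by (auto simp: Ec_def)
    qed
    have "(y, y) \<in> reach (Ec (c e))" by simp
    then have "(x, y) \<in> reach (Ec (c e))" using *[OF x] *[OF y] by auto
    then have "(x, y) \<in> reach {f \<in> Ec (c e). \<phi> f = (c e, {z. (x, z) \<in> reach (Ec (c e))})}"
      by (rule comp) simp
    then show "(x, y) \<in> reach {f \<in> edges G. \<phi> f = \<phi> e}"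
      by (rule reach_mono) (use *[OF x] in \<open>auto simp: Ec_def\<close>)
  next
    fix u v assume uv: "u \<in> verts G" "v \<in> verts G" "u \<noteq> v"
    have "\<exists>P. finite P \<and> card P \<ge> 2 \<and> edge_disjoint P \<and> (\<forall>p\<in>P. is_path G u v p \<and> monochromatic c p)"
      using c uv by (simp add: MC_coloring_def)
    then obtain P where P: "finite P" "card P \<ge> 2" "edge_disjoint P" "\<forall>p\<in>P. is_path G u v p \<and> monochromatic c p"
      by blast
    obtain p q where pq: "p \<in> P" "q \<in> P" "path_edges p \<inter> path_edges q = {}"
      using two_disjoint_elements[OF P(3,1,2)] by blast
    have path: "is_path G u v p" "is_path G u v q" using P(4) pq by auto
    have E: "path_edges p \<subseteq> edges G" "path_edges q \<subseteq> edges G" using path by (auto simp: is_path_def)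
    obtain a b where ab: "\<forall>e\<in>path_edges p. c e = a" "\<forall>e\<in>path_edges q. c e = b"
      using P(4) pq unfolding monochromatic_def by metis
    have p: "path_edges p \<subseteq> Ec a" and q: "path_edges q \<subseteq> Ec b" using ab E by (auto simp: Ec_def)
    let ?f = "\<lambda>a. (a, {z. (u, z) \<in> reach (Ec a)})"
    show "(\<exists>j. tied {f \<in> edges G. \<phi> f = j} u v) \<or>
      (\<exists>i j. i \<noteq> j \<and> (u, v) \<in> reach {f \<in> edges G. \<phi> f = i} \<and> (u, v) \<in> reach {f \<in> edges G. \<phi> f = j})"
    proof (cases "a = b")
      \<comment> \<open>Both paths start at \<open>u\<close> in the same colour, hence lie in the
        same component, and every deletion spares one of them.\<close>
      case True
      have "(u, v) \<in> reach ({f \<in> edges G. \<phi> f = ?f a} - {e})" for e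
      proof -
        have "path_edges p \<subseteq> Ec a - {e} \<or> path_edges q \<subseteq> Ec a - {e}" using p q pq(3) True by auto
        then have "(u, v) \<in> reach (Ec a - {e})" using is_path_reach path by metis
        then have "(u, v) \<in> reach {f \<in> Ec a - {e}. \<phi> f = ?f a}" by (rule comp) auto
        then show ?thesis by (rule reach_mono) (auto simp: Ec_def)
      qed
      then have "tied {f \<in> edges G. \<phi> f = ?f a} u v" by (simp add: tied_def)
      then show ?thesis by (intro disjI1 exI)
    next
      case False
      have sub: "{f \<in> Ec x. \<phi> f = ?f x} \<subseteq> {f \<in> edges G. \<phi> f = ?f x}" for x by (auto simp: Ec_def)
      have "(u, v) \<in> reach {f \<in> edges G. \<phi> f = ?f a}"
        by (rule reach_mono[OF comp[OF is_path_reach[OF path(1) p] order_refl] sub])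
      moreover have "(u, v) \<in> reach {f \<in> edges G. \<phi> f = ?f b}"
        by (rule reach_mono[OF comp[OF is_path_reach[OF path(2) q] order_refl] sub])
      moreover have "?f a \<noteq> ?f b" using False by simp
      ultimately show ?thesis by (intro disjI2 exI conjI)
    qed
  qed (use G' in \<open>auto simp: simple_graph_def\<close>)
  obtain D where D: "D \<subseteq> edges G" "conn2 (verts G) D" "card D + card P \<le> card (edges G) + 1"
    using few_colours by auto
  have "simple_graph (verts G, D)" using G'(1) D(1) by (auto simp: simple_graph_def)
  then have "spanning_subgraph (verts G, D) G" "k_edge_connected 2 (verts G, D)"
    using D G'(2) by (auto simp: spanning_subgraph_def k_edge_connected_2_iff)
  then have "e_num H \<le> card D"
    using H unfolding minimum_k_edge_connected_spanning_subgraph_def e_num_def by (metis snd_conv)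
  moreover have "card (c ` edges G) \<le> card P"
  proof -
    have "c ` edges G = fst ` P" by (auto simp: P_def \<phi>_def image_image)
    then show ?thesis using finP card_image_le by metis
  qed
  ultimately show ?thesis using D(3) by (simp add: e_num_def)
qed

section \<open>The lower bound for k = 2\<close>

lemma simple_graph_finite_edges: "simple_graph G \<Longrightarrow> finite (edges G)"
  by (rule finite_subset[of _ "Pow (verts G)"]) (auto simp: simple_graph_def)

lemma mc_eqI:
  assumes "simple_graph G" "MC_coloring k G c" "card (c ` edges G) = m"
    and "\<And>c'. MC_coloring k G c' \<Longrightarrow> card (c' ` edges G) \<le> m"
  shows "mc k G = m"
proof -
  have "{card (c ` edges G) | c. MC_coloring k G c} \<subseteq> {..m}" using assms(4) by auto
  then have "finite {card (c ` edges G) | c. MC_coloring k G c}" by (rule finite_subset) simp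
  then show ?thesis unfolding mc_def using assms by (intro Max_eqI) auto
qed

lemma is_path_mono: "is_path H u v p \<Longrightarrow> verts H = verts G \<Longrightarrow> edges H \<subseteq> edges G \<Longrightarrow> is_path G u v p"
  by (auto simp: is_path_def)

lemma MC_coloring_const_on_subgraph:
  assumes "k_edge_connected k H" "spanning_subgraph H G" "\<And>e. e \<in> edges H \<Longrightarrow> c e = a"
  shows "MC_coloring k G c"
  unfolding MC_coloring_def
proof (intro ballI impI)
  fix u v assume "u \<in> verts G" "v \<in> verts G" "u \<noteq> v"
  moreover have VH: "verts H = verts G" "edges H \<subseteq> edges G" using assms(2) by (auto simp: spanning_subgraph_def)
  ultimately have "\<exists>P. finite P \<and> k \<le> card P \<and> edge_disjoint P \<and> (\<forall>p\<in>P. is_path H u v p)"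
    using assms(1) by (simp add: k_edge_connected_def)
  then obtain P where P: "finite P" "k \<le> card P" "edge_disjoint P" "\<forall>p\<in>P. is_path H u v p" by blast
  have "is_path G u v p \<and> monochromatic c p" if "p \<in> P" for p
  proof -
    have p: "is_path H u v p" using P(4) that by simp
    then have "\<forall>e\<in>path_edges p. c e = a" using assms(3) by (auto simp: is_path_def)
    then show ?thesis using is_path_mono[OF p VH] unfolding monochromatic_def by blast
  qed
  then show "\<exists>P. finite P \<and> k \<le> card P \<and> edge_disjoint P \<and> (\<forall>p\<in>P. is_path G u v p \<and> monochromatic c p)"
    using P by (intro exI[of _ P]) simp
qed

lemma obtain_subgraph_coloring:
  fixes G H :: "'a ugraph"
  assumes "simple_graph G" "k_edge_connected k H" "spanning_subgraph H G" "edges H \<noteq> {}"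
  obtains c where "MC_coloring k G c" "card (c ` edges G) + e_num H = e_num G + 1"
proof -
  have fin: "finite (edges G)" by (rule simple_graph_finite_edges[OF assms(1)])
  have sub: "edges H \<subseteq> edges G" using assms(3) by (simp add: spanning_subgraph_def)
  obtain f :: "'a set \<Rightarrow> nat" where f: "inj_on f (edges G - edges H)"
    using finite_imp_inj_to_nat_seg[of "edges G - edges H"] fin by auto
  define c where "c e = (if e \<in> edges H then 0 else Suc (f e))" for e
  have "c ` edges G = insert 0 (c ` (edges G - edges H))" using sub assms(4) by (auto simp: c_def)
  moreover have "inj_on c (edges G - edges H)" using f by (auto simp: c_def inj_on_def)
  ultimately have "card (c ` edges G) = Suc (card (edges G - edges H))"
    using fin by (simp add: card_image card_insert_if) (auto simp: c_def)
  moreover have "card (edges G - edges H) + card (edges H) = card (edges G)"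
    using fin sub by (metis add.commute card_mono card_Diff_subset finite_subset le_add_diff_inverse)
  ultimately have "card (c ` edges G) + e_num H = e_num G + 1" by (simp add: e_num_def)
  moreover have "MC_coloring k G c"
    by (rule MC_coloring_const_on_subgraph[OF assms(2,3), of _ 0]) (simp add: c_def)
  ultimately show ?thesis using that by blast
qed

lemma mc_2:
  assumes G: "k_edge_connected 2 G" and H: "minimum_k_edge_connected_spanning_subgraph 2 H G"
  shows "mc 2 G + e_num H = e_num G + 1"
proof -
  have G': "simple_graph G" using G by (simp add: k_edge_connected_def)
  have H': "spanning_subgraph H G" "k_edge_connected 2 H"
    using H by (auto simp: minimum_k_edge_connected_spanning_subgraph_def)
  have ne: "edges H \<noteq> {}"
    using H'(2) conn2_edge_exists by (auto simp: k_edge_connected_2_iff)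
  obtain c where c: "MC_coloring 2 G c" "card (c ` edges G) + e_num H = e_num G + 1"
    using obtain_subgraph_coloring[OF G' H'(2,1) ne] by blast
  have "mc 2 G = card (c ` edges G)"
    using card_colours_le_2[OF G H] c by (intro mc_eqI[OF G' c(1) refl]) fastforce
  then show ?thesis using c by simp
qed

section \<open>Graphs covered by vertices of degree k\<close>

definition first_edge :: "'a list \<Rightarrow> 'a set" where "first_edge p = {p ! 0, p ! 1}"
definition last_edge :: "'a list \<Rightarrow> 'a set" where "last_edge p = {p ! (length p - 2), p ! (length p - 1)}"

lemma path_length:
  assumes "is_path G u v p" "u \<noteq> v"
  shows "2 \<le> length p" "p ! 0 = u" "p ! (length p - 1) = v"
proof -
  show "2 \<le> length p" using assms by (cases p; cases "tl p") (auto simp: is_path_def)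
  show "p ! 0 = u" "p ! (length p - 1) = v"
    using assms by (auto simp: is_path_def hd_conv_nth last_conv_nth)
qed

lemma first_edge: "is_path G u v p \<Longrightarrow> u \<noteq> v \<Longrightarrow> first_edge p \<in> path_edges p \<and> u \<in> first_edge p"
  using path_length[of G u v p] path_edges_nth[of 0 p] by (auto simp: first_edge_def)

lemma last_edge: "is_path G u v p \<Longrightarrow> u \<noteq> v \<Longrightarrow> last_edge p \<in> path_edges p \<and> v \<in> last_edge p"
  using path_length[of G u v p] path_edges_nth[of "length p - 2" p]
  by (auto simp: last_edge_def Suc_diff_le numeral_2_eq_2 Suc_diff_Suc)

lemma inj_on_chosen_edge:
  assumes "edge_disjoint P" "\<And>p. p \<in> P \<Longrightarrow> f p \<in> path_edges p"
  shows "inj_on f P"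
proof (rule inj_onI, rule ccontr)
  fix p q assume *: "p \<in> P" "q \<in> P" "f p = f q" "p \<noteq> q"
  then have "path_edges p \<inter> path_edges q = {}"
    using assms(1) by (auto simp: edge_disjoint_def pairwise_def disjnt_def)
  then show False using assms(2)[OF *(1)] assms(2)[OF *(2)] *(3) by auto
qed

lemma k_edge_connected_degree:
  assumes "k_edge_connected k H" "v \<in> verts H"
  shows "k \<le> card {e \<in> edges H. v \<in> e}"
proof -
  have H: "simple_graph H" "2 \<le> card (verts H)" using assms(1) by (auto simp: k_edge_connected_def)
  have "\<not> verts H \<subseteq> {v}" using H(2) card_mono[of "{v}" "verts H"] by auto
  then obtain w where w: "w \<in> verts H" "v \<noteq> w" by auto
  have "\<exists>P. finite P \<and> k \<le> card P \<and> edge_disjoint P \<and> (\<forall>p\<in>P. is_path H v w p)"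
    using assms w by (simp add: k_edge_connected_def)
  then obtain P where P: "finite P" "k \<le> card P" "edge_disjoint P" "\<And>p. p \<in> P \<Longrightarrow> is_path H v w p" by blast
  have fe: "first_edge p \<in> path_edges p \<and> v \<in> first_edge p" if "p \<in> P" for p
    using first_edge[OF P(4)[OF that] w(2)] .
  have "inj_on first_edge P" using inj_on_chosen_edge[OF P(3)] fe by blast
  then have "card P = card (first_edge ` P)" by (simp add: card_image)
  also have "\<dots> \<le> card {e \<in> edges H. v \<in> e}"
  proof (rule card_mono)
    show "finite {e \<in> edges H. v \<in> e}" using simple_graph_finite_edges[OF H(1)] by simp
    show "first_edge ` P \<subseteq> {e \<in> edges H. v \<in> e}" using fe P(4) by (auto simp: is_path_def)
  qed
  finally show ?thesis using P(2) by simp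
qed

text \<open>A vertex of \<open>W\<close> needs degree at least \<open>k\<close> in \<open>H\<close>
  and has at most that in \<open>G\<close>, so \<open>H\<close> keeps all edges there, and every
  edge has an end in \<open>W\<close>.\<close>

lemma k_regular_cover_edges_eq:
  assumes "simple_graph G" "k_edge_connected k H" "spanning_subgraph H G"
    and "W \<subseteq> verts G" "\<And>e. e \<in> edges G \<Longrightarrow> e \<inter> W \<noteq> {}"
    and deg: "\<And>w. w \<in> W \<Longrightarrow> card {e \<in> edges G. w \<in> e} \<le> k"
  shows "edges H = edges G"
proof
  show "edges H \<subseteq> edges G" using assms(3) by (simp add: spanning_subgraph_def)
  show "edges G \<subseteq> edges H"
  proof
    fix e assume e: "e \<in> edges G"
    then obtain w where w: "w \<in> e" "w \<in> W" using assms(5) by auto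
    have "w \<in> verts H" using w assms(3,4) by (auto simp: spanning_subgraph_def)
    then have "card {e \<in> edges G. w \<in> e} \<le> card {e \<in> edges H. w \<in> e}"
      using k_edge_connected_degree[OF assms(2)] deg[OF w(2)] by fastforce
    moreover have "{e \<in> edges H. w \<in> e} \<subseteq> {e \<in> edges G. w \<in> e}" using \<open>edges H \<subseteq> edges G\<close> by auto
    moreover have "finite {e \<in> edges G. w \<in> e}" using simple_graph_finite_edges[OF assms(1)] by simp
    ultimately have "{e \<in> edges H. w \<in> e} = {e \<in> edges G. w \<in> e}" by (metis card_seteq)
    then show "e \<in> edges H" using e w by auto
  qed
qed

text \<open>At a vertex of degree \<^term>\<open>k\<close> every edge starts one of the \<^term>\<open>k\<close> paths, so no colour has larger degree
  there than at any other vertex. The last hypothesis rules out colours of degree one.\<close>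

lemma k_regular_cover_colours:
  assumes G: "simple_graph G" and c: "MC_coloring k G c"
    and W: "W \<subseteq> verts G" "w0 \<in> W" "\<And>e. e \<in> edges G \<Longrightarrow> e \<inter> W \<noteq> {}"
    and deg: "\<And>w. w \<in> W \<Longrightarrow> card {e \<in> edges G. w \<in> e} \<le> k"
    and escape: "\<And>w x. w \<in> W \<Longrightarrow> {w, x} \<in> edges G \<Longrightarrow> \<exists>v\<in>verts G. v \<noteq> w \<and>
      (\<forall>p. is_path G w v p \<and> p ! 1 = x \<longrightarrow> (\<exists>i>0. Suc i < length p \<and> p ! i \<in> W))"
  shows "2 * card (c ` edges G) \<le> k"
proof -
  have finE: "finite (edges G)" by (rule simple_graph_finite_edges[OF G])
  define d where "d a v = card {e \<in> edges G. v \<in> e \<and> c e = a}" for a v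
  have paths: "\<exists>P. inj_on first_edge P \<and> inj_on last_edge P \<and> first_edge ` P = {e \<in> edges G. w \<in> e} \<and> finite P \<and>
      (\<forall>p\<in>P. is_path G w v p \<and> (\<forall>e\<in>path_edges p. c e = c (first_edge p)))"
    if w: "w \<in> W" and v: "v \<in> verts G" "v \<noteq> w" for w v
  proof -
    have "\<exists>P. finite P \<and> k \<le> card P \<and> edge_disjoint P \<and> (\<forall>p\<in>P. is_path G w v p \<and> monochromatic c p)"
      using c v subsetD[OF W(1) w] v(2)[symmetric] by (simp add: MC_coloring_def)
    then obtain P where P: "finite P" "k \<le> card P" "edge_disjoint P" "\<And>p. p \<in> P \<Longrightarrow> is_path G w v p"
      "\<And>p. p \<in> P \<Longrightarrow> monochromatic c p" by blast
    have fe: "first_edge p \<in> path_edges p \<and> w \<in> first_edge p" if "p \<in> P" for p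
      using first_edge[OF P(4)[OF that]] v by auto
    have inj: "inj_on first_edge P" using inj_on_chosen_edge[OF P(3)] fe by blast
    have inj': "inj_on last_edge P"
      using inj_on_chosen_edge[OF P(3), of last_edge] last_edge[OF P(4)] v(2) by metis
    have "first_edge ` P = {e \<in> edges G. w \<in> e}"
    proof (rule card_seteq)
      show "first_edge ` P \<subseteq> {e \<in> edges G. w \<in> e}" using fe P(4) by (auto simp: is_path_def)
      show "card {e \<in> edges G. w \<in> e} \<le> card (first_edge ` P)"
        using deg[OF w] P(2) card_image[OF inj] by simp
    qed (use finE in simp)
    moreover have "c e = c (first_edge p)" if "p \<in> P" "e \<in> path_edges p" for p e
      using P(5)[OF that(1)] fe[OF that(1)] that(2) unfolding monochromatic_def by metis
    ultimately show ?thesis using inj inj' P(1,4) by (intro exI[of _ P]) simp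
  qed
  have d_le: "d a w \<le> d a v" if w: "w \<in> W" and v: "v \<in> verts G" for a w v
  proof (cases "v = w")
    case False
    obtain P where P: "inj_on first_edge P" "inj_on last_edge P" "first_edge ` P = {e \<in> edges G. w \<in> e}" "finite P"
      "\<And>p. p \<in> P \<Longrightarrow> is_path G w v p" "\<And>p e. p \<in> P \<Longrightarrow> e \<in> path_edges p \<Longrightarrow> c e = c (first_edge p)"
      using paths[OF w v False] by blast
    define Q where "Q = {p \<in> P. c (first_edge p) = a}"
    have "{e \<in> edges G. w \<in> e \<and> c e = a} = first_edge ` Q"
    proof -
      have "{e \<in> edges G. w \<in> e \<and> c e = a} = {e \<in> first_edge ` P. c e = a}" using P(3) by auto
      then show ?thesis by (auto simp: Q_def)
    qed
    then have "d a w = card Q"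
      unfolding d_def using P(1) by (simp add: card_image inj_on_subset[of _ P] Q_def)
    also have "\<dots> = card (last_edge ` Q)" using P(2) by (simp add: card_image inj_on_subset[of _ P] Q_def)
    also have "\<dots> \<le> d a v"
      unfolding d_def
    proof (rule card_mono)
      show "last_edge ` Q \<subseteq> {e \<in> edges G. v \<in> e \<and> c e = a}"
      proof
        fix e assume "e \<in> last_edge ` Q"
        then obtain p where p: "p \<in> P" "c (first_edge p) = a" "e = last_edge p" by (auto simp: Q_def)
        have "e \<in> path_edges p" "v \<in> e" using last_edge[OF P(5)[OF p(1)]] False p(3) by auto
        then show "e \<in> {e \<in> edges G. v \<in> e \<and> c e = a}"
          using P(5,6)[OF p(1)] p(2) by (auto simp: is_path_def)
      qed
    qed (use finE in simp)
    finally show ?thesis .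
  qed simp
  have pos: "0 < d (c e) v" if "e \<in> edges G" "v \<in> e" for e v
    using that finE by (auto simp: d_def card_gt_0_iff)
  \<comment> \<open>By \<open>d_le\<close> a colour has the same degree at all vertices of
    \<open>W\<close>, so one such vertex with two edges suffices. The path that begins with an edge
    of the colour at \<open>w0\<close> has an inner vertex in \<open>W\<close>, with two path edges
    at it.\<close>
  have two: "2 \<le> d a w0" if "a \<in> c ` edges G" for a
  proof (rule ccontr)
    assume less: "\<not> 2 \<le> d a w0"
    obtain e where e0: "e \<in> edges G" "c e = a" using \<open>a \<in> c ` edges G\<close> by auto
    obtain y where "y \<in> e" "y \<in> W" using W(3)[OF e0(1)] by auto
    note e = e0 this
    have "0 < d a w0" using pos[OF e(1,3)] e(2) d_le[OF e(4), of w0 a] W by auto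
    then obtain f where f: "f \<in> edges G" "w0 \<in> f" "c f = a"
      unfolding d_def card_gt_0_iff by auto
    have "card f = 2" using f G by (auto simp: simple_graph_def)
    then obtain x where x: "f = {w0, x}" using f(2) by (auto simp: card_2_iff)
    obtain v where v: "v \<in> verts G" "v \<noteq> w0"
      "\<And>p. is_path G w0 v p \<Longrightarrow> p ! 1 = x \<Longrightarrow> \<exists>i>0. Suc i < length p \<and> p ! i \<in> W"
      using escape[OF W(2)] f(1) unfolding x by metis
    obtain P where P: "first_edge ` P = {e \<in> edges G. w0 \<in> e}"
      "\<And>p. p \<in> P \<Longrightarrow> is_path G w0 v p" "\<And>p e. p \<in> P \<Longrightarrow> e \<in> path_edges p \<Longrightarrow> c e = c (first_edge p)"
      using paths[OF W(2) v(1,2)] by blast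
    have "f \<in> first_edge ` P" using P(1) f by auto
    then obtain p where p: "p \<in> P" "first_edge p = f" by auto
    have pw: "p ! 0 = w0" using path_length[OF P(2)[OF p(1)]] v by auto
    then have "p ! 1 = x" using p(2) x by (auto simp: first_edge_def doubleton_eq_iff)
    then obtain i where i: "0 < i" "Suc i < length p" "p ! i \<in> W" using v(3) P(2)[OF p(1)] by blast
    have dist: "distinct p" and pE: "path_edges p \<subseteq> edges G" using P(2)[OF p(1)] by (auto simp: is_path_def)
    define g h where "g = {p ! (i - 1), p ! i}" and "h = {p ! i, p ! Suc i}"
    have gh: "g \<in> path_edges p" "h \<in> path_edges p"
      using path_edges_nth[of "i - 1" p] path_edges_nth[of i p] i by (auto simp: g_def h_def)
    have "p ! (i - 1) \<noteq> p ! Suc i" "p ! i \<noteq> p ! Suc i" using dist i by (auto simp: nth_eq_iff_index_eq)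
    then have "g \<noteq> h" by (auto simp: g_def h_def doubleton_eq_iff)
    moreover have "{g, h} \<subseteq> {e \<in> edges G. p ! i \<in> e \<and> c e = a}"
      using gh pE P(3)[OF p(1)] p(2) f(3) by (auto simp: g_def h_def)
    then have "card {g, h} \<le> d a (p ! i)" unfolding d_def using finE by (intro card_mono) auto
    ultimately show False using d_le[OF i(3), of w0 a] W less by auto
  qed
  have "(\<Sum>a\<in>c ` edges G. 2) \<le> (\<Sum>a\<in>c ` edges G. d a w0)" using two by (intro sum_mono) simp
  also have "\<dots> = card (\<Union>a\<in>c ` edges G. {e \<in> edges G. w0 \<in> e \<and> c e = a})"
    unfolding d_def using finE by (intro card_UN_disjoint[symmetric]) auto
  also have "(\<Union>a\<in>c ` edges G. {e \<in> edges G. w0 \<in> e \<and> c e = a}) = {e \<in> edges G. w0 \<in> e}" by auto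
  finally show ?thesis using deg[OF W(2)] by simp
qed

section \<open>Colourings with spanning 2-edge-connected classes\<close>

lemma MC_coloring_conn2_classes:
  assumes G: "simple_graph G" and conn: "\<And>a. a < m \<Longrightarrow> conn2 (verts G) {e \<in> edges G. c e = a}"
  shows "MC_coloring (2 * m) G c"
  unfolding MC_coloring_def
proof (intro ballI impI)
  fix u v assume uv: "u \<in> verts G" "v \<in> verts G" "u \<noteq> v"
  define R where "R a p q \<longleftrightarrow> is_path G u v p \<and> is_path G u v q \<and> path_edges p \<subseteq> {e \<in> edges G. c e = a} \<and>
      path_edges q \<subseteq> {e \<in> edges G. c e = a} \<and> path_edges p \<inter> path_edges q = {}" for a p q
  have "\<exists>p q. R a p q" if "a < m" for a
  proof -
    have "{e \<in> edges G. c e = a} \<subseteq> edges G" by auto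
    then show ?thesis
    proof (rule conn2_two_paths[OF G _ conn[OF that] uv])
      fix p q
      assume "is_path G u v p" "is_path G u v q" "path_edges p \<subseteq> {e \<in> edges G. c e = a}"
        "path_edges q \<subseteq> {e \<in> edges G. c e = a}" "path_edges p \<inter> path_edges q = {}"
      then have "R a p q" unfolding R_def by (intro conjI)
      then show ?thesis by (intro exI)
    qed
  qed
  then obtain p q where "\<And>a. a < m \<Longrightarrow> R a (p a) (q a)" by metis
  then have pq: "\<And>a. a < m \<Longrightarrow> is_path G u v (p a)" "\<And>a. a < m \<Longrightarrow> is_path G u v (q a)"
    "\<And>a. a < m \<Longrightarrow> path_edges (p a) \<subseteq> {e \<in> edges G. c e = a}"
    "\<And>a. a < m \<Longrightarrow> path_edges (q a) \<subseteq> {e \<in> edges G. c e = a}"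
    "\<And>a. a < m \<Longrightarrow> path_edges (p a) \<inter> path_edges (q a) = {}"
    unfolding R_def by (blast+)
  \<comment> \<open>Two paths for each of the \<open>m\<close> classes. The family is injective
    because the edge sets are disjoint and nonempty.\<close>
  define r where "r i = (if snd i then p (fst i) else q (fst i))" for i :: "nat \<times> bool"
  define I where "I = {..<m} \<times> (UNIV :: bool set)"
  have r: "is_path G u v (r i)" "path_edges (r i) \<subseteq> {e \<in> edges G. c e = fst i}" if "i \<in> I" for i
    using that pq(1-4)[of "fst i"] unfolding r_def I_def by (cases "snd i"; simp add: mem_Times_iff)+
  have disj: "path_edges (r i) \<inter> path_edges (r j) = {}" if "i \<in> I" "j \<in> I" "i \<noteq> j" for i j
  proof (cases "fst i = fst j")
    case True
    then have "snd i \<noteq> snd j" using that(3) by (simp add: prod_eq_iff)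
    then show ?thesis using pq(5)[of "fst j"] that True by (auto simp: r_def I_def)
  next
    case False
    have col: "c e = fst i" if "i \<in> I" "e \<in> path_edges (r i)" for e i
      using subsetD[OF r(2)[OF that(1)] that(2)] by simp
    show ?thesis
    proof (rule equals0I)
      fix e assume "e \<in> path_edges (r i) \<inter> path_edges (r j)"
      then show False using col[OF that(1), of e] col[OF that(2), of e] False by simp
    qed
  qed
  have ne: "path_edges (r i) \<noteq> {}" if "i \<in> I" for i
    using first_edge[OF r(1)[OF that] uv(3)] by auto
  have "inj_on r I"
  proof (rule inj_onI, rule ccontr)
    fix i j assume "i \<in> I" "j \<in> I" "r i = r j" "i \<noteq> j"
    then show False using disj[of i j] ne[of j] by simp
  qed
  then have "card (r ` I) = 2 * m" by (simp add: card_image I_def card_cartesian_product)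
  moreover have "edge_disjoint (r ` I)"
    unfolding edge_disjoint_def pairwise_def disjnt_def
  proof (intro ballI impI)
    fix x y assume "x \<in> r ` I" "y \<in> r ` I" "x \<noteq> y"
    then obtain i j where "i \<in> I" "j \<in> I" "x = r i" "y = r j" "i \<noteq> j" by blast
    then show "path_edges x \<inter> path_edges y = {}" using disj[of i j] by simp
  qed
  moreover have "\<forall>p\<in>r ` I. is_path G u v p \<and> monochromatic c p"
  proof
    fix x assume "x \<in> r ` I"
    then obtain i where i: "i \<in> I" "x = r i" by blast
    have "\<forall>e\<in>path_edges x. c e = fst i" using r(2)[OF i(1)] i(2) by auto
    then show "is_path G u v x \<and> monochromatic c x"
      using r(1)[OF i(1)] i(2) unfolding monochromatic_def by blast
  qed
  moreover have "finite (r ` I)" by (simp add: I_def)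
  ultimately show "\<exists>P. finite P \<and> 2 * m \<le> card P \<and> edge_disjoint P \<and> (\<forall>p\<in>P. is_path G u v p \<and> monochromatic c p)"
    by (intro exI[of _ "r ` I"]) simp
qed

lemma card_colours_conn2_classes:
  assumes "2 \<le> card (verts G)" "\<And>a. a < m \<Longrightarrow> conn2 (verts G) {e \<in> edges G. c e = a}"
    and "\<And>e. e \<in> edges G \<Longrightarrow> c e < m"
  shows "card (c ` edges G) = m"
proof -
  have "c ` edges G = {..<m}"
  proof
    show "{..<m} \<subseteq> c ` edges G"
    proof
      fix a assume "a \<in> {..<m}"
      then have "{e \<in> edges G. c e = a} \<noteq> {}" using conn2_edge_exists[OF assms(2,1)] by simp
      then show "a \<in> c ` edges G" by auto
    qed
  qed (use assms(3) in auto)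
  then show ?thesis by simp
qed

lemma mod_eq_close:
  fixes p q k :: nat
  assumes "p mod k = q mod k" "p < q + k" "q < p + k"
  shows "p = q"
proof -
  have ord: "p = q" if "p mod k = q mod k" "p \<le> q" "q < p + k" for p q :: nat
  proof -
    have "k dvd q - p" using that mod_eq_dvd_iff_nat[of p q k] by simp
    moreover have "q - p < k" using that by simp
    ultimately show ?thesis using that nat_dvd_not_less[of "q - p" k] by (cases "q - p = 0") auto
  qed
  show ?thesis using ord[of p q] ord[of q p] assms by (cases "p \<le> q") auto
qed

text \<open>The summand \<open>k\<close> keeps the difference of the residues from being cut off at
  0.\<close>

lemma mod_diff_nat:
  fixes x y k :: nat
  assumes "y \<le> x" "0 < k"
  shows "(x mod k + k - y mod k) mod k = (x - y) mod k"
proof -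
  have "y mod k \<le> x mod k + k" using assms(2) by (meson le_add2 less_imp_le mod_less_divisor order_trans)
  then have "int ((x mod k + k - y mod k) mod k) = (int x mod int k + int k - int y mod int k) mod int k"
    by (simp add: zmod_int of_nat_diff)
  also have "\<dots> = (int x - int y) mod int k"
    by (metis add.commute add_diff_eq mod_add_self1 mod_diff_eq)
  also have "\<dots> = int ((x - y) mod k)" using assms(1) by (simp add: zmod_int of_nat_diff)
  finally show ?thesis by simp
qed

text \<open>Walecki's decomposition: a point \<open>\<gamma> k\<close> at infinity is joined to the ends of the zigzag Hamiltonian paths of
  \<open>{0..<k}\<close>, along which the sums of consecutive elements alternate between \<open>2a\<close> and \<open>2a + 1\<close> modulo \<open>k\<close>.\<close>

lemma complete_graph_coloring:
  fixes G :: "'a ugraph"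
  assumes G: "complete_graph (k + 1) G" and k: "k = 2 * m" "2 \<le> k"
  obtains c where "\<And>a. a < m \<Longrightarrow> conn2 (verts G) {e \<in> edges G. c e = a}"
    "\<And>e. e \<in> edges G \<Longrightarrow> c e < m"
proof -
  have fin: "finite (verts G)" and card: "card (verts G) = k + 1"
    and E: "edges G = {{u, v} | u v. u \<in> verts G \<and> v \<in> verts G \<and> u \<noteq> v}"
    using G by (auto simp: complete_graph_def)
  obtain \<gamma> where \<gamma>: "bij_betw \<gamma> {0..<k + 1} (verts G)"
    using ex_bij_betw_nat_finite[OF fin] card by auto
  have \<gamma>V: "\<gamma> i \<in> verts G" if "i \<le> k" for i using bij_betwE[OF \<gamma>] that by auto
  have \<gamma>_eq: "\<gamma> i = \<gamma> j \<longleftrightarrow> i = j" if "i \<le> k" "j \<le> k" for i j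
    using bij_betw_imp_inj_on[OF \<gamma>] that by (auto simp: inj_on_def)
  define \<iota> where "\<iota> = inv_into {0..<k + 1} \<gamma>"
  have \<iota>: "\<iota> (\<gamma> i) = i" if "i \<le> k" for i
    using that inv_into_f_f[OF bij_betw_imp_inj_on[OF \<gamma>], of i] by (simp add: \<iota>_def)
  \<comment> \<open>For an edge at infinity \<open>Min\<close> picks out the finite end, and
    \<open>mod m\<close> identifies the two ends \<open>a\<close> and \<open>a + m\<close> of a
    zigzag path. For the other edges \<open>div 2\<close> merges the sums \<open>2a\<close> and
    \<open>2a + 1\<close>.\<close>
  define c where "c e = (if k \<in> \<iota> ` e then Min (\<iota> ` e) mod m else (\<Sum>(\<iota> ` e) mod k) div 2)" for e
  have cinf: "c {\<gamma> k, \<gamma> i} = i mod m" if "i < k" for i using that by (simp add: c_def \<iota>)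
  have csum: "c {\<gamma> i, \<gamma> j} = ((i + j) mod k) div 2" if "i < k" "j < k" "i \<noteq> j" for i j
    using that by (simp add: c_def \<iota>)
  have EI: "{\<gamma> i, \<gamma> j} \<in> edges G" if "i \<le> k" "j \<le> k" "i \<noteq> j" for i j
    using that \<gamma>V \<gamma>_eq unfolding E by blast
  have less: "c e < m" if "e \<in> edges G" for e
  proof -
    have "(\<Sum>(\<iota> ` e) mod k) < k" using k(2) by (intro mod_less_divisor) simp
    then have "(\<Sum>(\<iota> ` e) mod k) div 2 < m" using k(1) by (intro less_mult_imp_div_less) simp
    then show ?thesis unfolding c_def by (cases "k \<in> \<iota> ` e") simp_all
  qed
  have conn: "conn2 (verts G) {e \<in> edges G. c e = a}" if a: "a < m" for a
  proof -
    \<comment> \<open>The zigzag a, a + 1, a - 1, a + 2, ..., with \<open>k\<close> added at even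
      places to avoid negative numbers. For \<open>t < k\<close> its values fill the window from
      \<open>a + 1\<close> to \<open>a + k\<close>, so the residues are distinct.\<close>
    define p where "p t = (if even t then a + k - t div 2 else a + t div 2 + 1)" for t
    define x where "x t = p t mod k" for t
    have xk: "x t < k" for t using k by (simp add: x_def)
    have x_inj: "t = t'" if "x t = x t'" "t < k" "t' < k" for t t'
    proof -
      have "t div 2 < m" "t' div 2 < m" using that k by auto
      then have "p t < p t' + k" "p t' < p t + k" using a k by (auto simp: p_def)
      then have "p t = p t'" using mod_eq_close[of "p t" k "p t'"] that(1) by (simp add: x_def)
      then show ?thesis
        using \<open>t div 2 < m\<close> \<open>t' div 2 < m\<close> k by (auto simp: p_def split: if_splits elim!: evenE oddE)
    qed
    define s where "s t = (if t = 0 \<or> t = Suc k then \<gamma> k else \<gamma> (x (t - 1)))" for t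
    have inj: "inj_on s {..<Suc k}"
    proof (rule inj_onI)
      fix t t' assume *: "t \<in> {..<Suc k}" "t' \<in> {..<Suc k}" "s t = s t'"
      have nk: "\<gamma> (x i) \<noteq> \<gamma> k" for i using \<gamma>_eq[of "x i" k] xk[of i] by simp
      have "t = 0 \<longleftrightarrow> t' = 0"
        using * nk[of "t - 1"] nk[of "t' - 1", symmetric] by (auto simp: s_def split: if_splits)
      show "t = t'"
      proof (cases "t = 0")
        case False
        then have t: "0 < t" "0 < t'" "t < Suc k" "t' < Suc k" using * \<open>t = 0 \<longleftrightarrow> t' = 0\<close> by auto
        then have "\<gamma> (x (t - 1)) = \<gamma> (x (t' - 1))" using *(3) by (simp add: s_def)
        then have "x (t - 1) = x (t' - 1)" using \<gamma>_eq xk less_imp_le by metis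
        then have "t - 1 = t' - 1" by (rule x_inj) (use t in linarith)+
        then show ?thesis using t by linarith
      qed (use \<open>t = 0 \<longleftrightarrow> t' = 0\<close> in simp)
    qed
    have sV: "s t \<in> verts G" for t using \<gamma>V xk by (auto simp: s_def less_imp_le)
    have "s ` {..<Suc k} = verts G"
      using fin card sV card_image[OF inj] by (intro card_subset_eq) auto
    moreover have "conn2 (s ` {..<Suc k}) {e \<in> edges G. c e = a}"
    proof (rule conn2_cycle[OF inj])
      fix t assume t: "t < Suc k"
      consider "t = 0" | "t = k" | "0 < t" "t < k" using t by linarith
      then show "{s t, s (Suc t)} \<in> {e \<in> edges G. c e = a}"
      proof cases
        case 1
        have "x 0 = a" using a k by (simp add: x_def p_def)
        then show ?thesis using 1 cinf[of a] EI[of k a] a k by (simp add: s_def)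
      next
        case 2
        have "odd (k - 1)" "(k - 1) div 2 = m - 1" using k by auto
        then have "x (k - 1) = a + m" using a k by (simp add: x_def p_def)
        then show ?thesis using 2 cinf[of "a + m"] EI[of k "a + m"] a k
          by (simp add: s_def insert_commute)
      next
        case 3
        define i where "i = t - 1"
        have i: "t = Suc i" "Suc i < k" using 3 by (auto simp: i_def)
        have ne: "x i \<noteq> x (Suc i)" using x_inj[of i "Suc i"] i by auto
        have "2 * a + 1 < k" using a k by simp
        then have mods: "(2 * a + 1 + k) mod k = 2 * a + 1" "(2 * a + k) mod k = 2 * a"
          by (simp_all only: mod_add_self2) simp_all
        have "p i + p (Suc i) = (if even i then 2 * a + 1 + k else 2 * a + k)"
          using i k by (auto simp: p_def elim!: evenE oddE)
        then have "(x i + x (Suc i)) mod k = (if even i then 2 * a + 1 else 2 * a)"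
          unfolding x_def mod_add_eq using mods by (cases "even i") (simp_all only: if_True if_False)
        then have "c {\<gamma> (x i), \<gamma> (x (Suc i))} = a" using csum[OF xk xk ne] by simp
        then show ?thesis using i EI[OF _ _ ne] xk by (simp add: s_def less_imp_le)
      qed
    qed (use k in \<open>auto simp: s_def\<close>)
    ultimately show ?thesis by simp
  qed
  show ?thesis using that[of c] conn less by blast
qed

text \<open>Colour \<open>a\<close> joins \<open>\<alpha> i\<close> with \<open>\<beta> j\<close> if \<open>j - i\<close> is \<open>2a\<close> or \<open>2a + 1\<close> modulo \<open>k\<close>: a Hamiltonian cycle if \<open>n = k\<close>, to
  which the further \<open>\<beta> j\<close> are attached by two edges each.\<close>

lemma complete_bipartite_coloring:
  fixes G :: "'a ugraph"
  assumes fin: "finite A" "finite B" "A \<inter> B = {}" "card A = k" "card B = n"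
    and V: "verts G = A \<union> B" and E: "edges G = {{a, b} | a b. a \<in> A \<and> b \<in> B}"
    and k: "k = 2 * m" "2 \<le> k" "k \<le> n"
  obtains c where "\<And>a. a < m \<Longrightarrow> conn2 (verts G) {e \<in> edges G. c e = a}"
    "\<And>e. e \<in> edges G \<Longrightarrow> c e < m"
proof -
  obtain \<alpha> where \<alpha>: "bij_betw \<alpha> {0..<k} A" using ex_bij_betw_nat_finite[OF fin(1)] fin(4) by auto
  obtain \<beta> where \<beta>: "bij_betw \<beta> {0..<n} B" using ex_bij_betw_nat_finite[OF fin(2)] fin(5) by auto
  have \<alpha>A: "\<alpha> i \<in> A" if "i < k" for i using bij_betwE[OF \<alpha>] that by auto
  have \<beta>B: "\<beta> i \<in> B" if "i < n" for i using bij_betwE[OF \<beta>] that by auto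
  have \<alpha>_eq: "\<alpha> i = \<alpha> j \<longleftrightarrow> i = j" if "i < k" "j < k" for i j
    using bij_betw_imp_inj_on[OF \<alpha>] that by (auto simp: inj_on_def)
  have \<beta>_eq: "\<beta> i = \<beta> j \<longleftrightarrow> i = j" if "i < n" "j < n" for i j
    using bij_betw_imp_inj_on[OF \<beta>] that by (auto simp: inj_on_def)
  define \<iota> where "\<iota> = inv_into {0..<k} \<alpha>"
  define \<kappa> where "\<kappa> = inv_into {0..<n} \<beta>"
  have \<iota>: "\<iota> (\<alpha> i) = i" if "i < k" for i
    using that inv_into_f_f[OF bij_betw_imp_inj_on[OF \<alpha>], of i] by (simp add: \<iota>_def)
  have \<kappa>: "\<kappa> (\<beta> i) = i" if "i < n" for i
    using that inv_into_f_f[OF bij_betw_imp_inj_on[OF \<beta>], of i] by (simp add: \<kappa>_def)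
  define c where "c e = ((\<kappa> (the_elem (e \<inter> B)) mod k + k - \<iota> (the_elem (e \<inter> A))) mod k) div 2" for e
  have c: "c {\<alpha> i, \<beta> j} = ((j mod k + k - i) mod k) div 2" if "i < k" "j < n" for i j
  proof -
    have "{\<alpha> i, \<beta> j} \<inter> B = {\<beta> j}" "{\<alpha> i, \<beta> j} \<inter> A = {\<alpha> i}" using \<alpha>A \<beta>B that fin(3) by auto
    then show ?thesis using that by (simp add: c_def \<iota> \<kappa>)
  qed
  have EI: "{\<alpha> i, \<beta> j} \<in> edges G" if "i < k" "j < n" for i j
    using that \<alpha>A \<beta>B unfolding E by blast
  have less: "c e < m" for e
  proof -
    have "(\<kappa> (the_elem (e \<inter> B)) mod k + k - \<iota> (the_elem (e \<inter> A))) mod k < k"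
      using k(2) by (intro mod_less_divisor) simp
    then show ?thesis unfolding c_def using k(1) by (intro less_mult_imp_div_less) simp
  qed
  have conn: "conn2 (verts G) {e \<in> edges G. c e = a}" if a: "a < m" for a
  proof -
    let ?D = "{e \<in> edges G. c e = a}"
    \<comment> \<open>The cycle runs from \<open>\<alpha> i\<close> to
      \<open>\<beta> (i + 2a + 1)\<close> and on to \<open>\<alpha> (i + 1)\<close>, with indices
      modulo \<open>k\<close>: the differences alternate between \<open>2a + 1\<close> and
      \<open>2a\<close>.\<close>
    define i where "i t = (t div 2) mod k" for t :: nat
    define j where "j t = (t div 2 + 2 * a + 1) mod k" for t :: nat
    have ik: "i t < k" and jk: "j t < k" and jn: "j t < n" for t
    proof -
      show "i t < k" "j t < k" using k by (auto simp: i_def j_def)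
      then show "j t < n" using k by simp
    qed
    define s where "s t = (if even t then \<alpha> (i t) else \<beta> (j t))" for t
    have AB: "\<alpha> i \<noteq> \<beta> j" if "i < k" "j < n" for i j using \<alpha>A \<beta>B that fin(3) by fastforce
    have inj: "inj_on s {..<2 * k}"
    proof (rule inj_onI)
      fix t t' assume *: "t \<in> {..<2 * k}" "t' \<in> {..<2 * k}" "s t = s t'"
      have t: "t div 2 < k" "t' div 2 < k" using * by auto
      have par: "even t \<longleftrightarrow> even t'" using * AB[of "i t" "j t'"] AB[of "i t'" "j t"] ik jn
        by (auto simp: s_def split: if_splits)
      have "t div 2 = t' div 2"
      proof (cases "even t")
        case True
        then have "i t = i t'" using * par \<alpha>_eq ik by (simp add: s_def)
        then show ?thesis using t by (simp add: i_def)
      next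
        case False
        then have "j t = j t'" using * par \<beta>_eq jn by (simp add: s_def)
        then show ?thesis
          using mod_eq_close[of "t div 2 + 2 * a + 1" k "t' div 2 + 2 * a + 1"] t by (simp add: j_def)
      qed
      then show "t = t'" using par by (auto elim!: evenE oddE)
    qed
    have "conn2 (s ` {..<2 * k}) ?D"
    proof (rule conn2_cycle[OF inj])
      fix t assume t: "t < 2 * k"
      show "{s t, s (Suc t)} \<in> ?D"
      proof (cases "even t")
        case True
        then have "i (Suc t) = i t" "j (Suc t) = j t" by (auto simp: i_def j_def)
        moreover have "(j t mod k + k - i t) mod k = 2 * a + 1"
          using mod_diff_nat[of "t div 2" "t div 2 + 2 * a + 1" k] a k by (simp add: i_def j_def)
        ultimately show ?thesis using True c[OF ik jn, of t t] EI[OF ik jn, of t t] by (simp add: s_def)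
      next
        case False
        then have d: "Suc t div 2 = Suc (t div 2)" by (auto elim!: oddE)
        have "(j t mod k + k - i (Suc t)) mod k = 2 * a"
          using mod_diff_nat[of "Suc (t div 2)" "t div 2 + 2 * a + 1" k] a k by (simp add: i_def j_def d)
        then show ?thesis using False c[OF ik jn, of "Suc t" t] EI[OF ik jn, of "Suc t" t]
          by (simp add: s_def insert_commute)
      qed
    next
      show "s (2 * k) = s 0" by (simp add: s_def i_def)
    qed (use k in simp)
    then show ?thesis
    proof (rule conn2_extend)
      fix v e assume v: "v \<in> verts G" "v \<notin> s ` {..<2 * k}"
      have A: "\<alpha> l \<in> s ` {..<2 * k}" if "l < k" for l
        using that by (intro image_eqI[of _ _ "2 * l"]) (auto simp: s_def i_def)
      have "A = \<alpha> ` {0..<k}" "B = \<beta> ` {0..<n}" using \<alpha> \<beta> by (auto simp: bij_betw_def)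
      then obtain l where l: "l < n" "v = \<beta> l" using v A unfolding V by auto
      \<comment> \<open>Solving \<open>l - i = 2a + b\<close> modulo \<open>k\<close> for
        \<open>i\<close> gives the two neighbours of \<open>\<beta> l\<close> in colour
        \<open>a\<close>, one for each of \<open>b = 0\<close> and \<open>b = 1\<close>.\<close>
      define q where "q b = (l + k - (2 * a + b)) mod k" for b
      have qk: "q b < k" for b using k by (simp add: q_def)
      have q: "{\<alpha> (q b), \<beta> l} \<in> ?D" if "b \<le> 1" for b
      proof -
        have "(l mod k + k - q b mod k) mod k = ((l + k) mod k + k - q b mod k) mod k" by simp
        also have "\<dots> = ((l + k) mod k + k - (l + k - (2 * a + b)) mod k) mod k" by (simp add: q_def)
        also have "\<dots> = (l + k - (l + k - (2 * a + b))) mod k" using k by (intro mod_diff_nat) auto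
        also have "\<dots> = 2 * a + b" using a k that by simp
        finally show ?thesis using c[OF qk l(1), of b] EI[OF qk l(1), of b] qk[of b] that by simp
      qed
      have "q 0 \<noteq> q 1"
      proof
        assume "q 0 = q 1"
        then have "(l + k - 2 * a) mod k = (l + k - (2 * a + 1)) mod k" by (simp add: q_def)
        then have "l + k - 2 * a = l + k - (2 * a + 1)" by (rule mod_eq_close) (use a k in arith)+
        then show False using a k by arith
      qed
      then have "{\<alpha> (q 0), \<beta> l} \<noteq> {\<alpha> (q 1), \<beta> l}" using \<alpha>_eq[OF qk qk] by (auto simp: doubleton_eq_iff)
      then obtain b :: nat where b: "b \<le> 1" "{\<alpha> (q b), \<beta> l} \<noteq> e" by (metis order_refl zero_le)
      then have "(v, \<alpha> (q b)) \<in> reach (?D - {e})"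
        using q[OF b(1)] l(2) by (intro reach_edge) (auto simp: insert_commute)
      then show "\<exists>b\<in>s ` {..<2 * k}. (v, b) \<in> reach (?D - {e})" using A[OF qk] by blast
    qed simp
  qed
  show ?thesis using that[of c] conn less by blast
qed

section \<open>Complete and complete bipartite graphs\<close>

lemma simple_complete: "complete_graph n G \<Longrightarrow> simple_graph G"
  by (auto simp: complete_graph_def simple_graph_def)

lemma regular_cover_mc:
  assumes G: "simple_graph G" and H: "minimum_k_edge_connected_spanning_subgraph k H G"
    and W: "W \<subseteq> verts G" "w0 \<in> W" "\<And>e. e \<in> edges G \<Longrightarrow> e \<inter> W \<noteq> {}"
    and deg: "\<And>w. w \<in> W \<Longrightarrow> card {e \<in> edges G. w \<in> e} \<le> k"
    and escape: "\<And>w x. w \<in> W \<Longrightarrow> {w, x} \<in> edges G \<Longrightarrow> \<exists>v\<in>verts G. v \<noteq> w \<and>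
      (\<forall>p. is_path G w v p \<and> p ! 1 = x \<longrightarrow> (\<exists>i>0. Suc i < length p \<and> p ! i \<in> W))"
    and c: "MC_coloring k G c" "card (c ` edges G) = k div 2"
  shows "mc k G + e_num H = e_num G + k div 2"
proof -
  have H': "spanning_subgraph H G" "k_edge_connected k H"
    using H by (auto simp: minimum_k_edge_connected_spanning_subgraph_def)
  have "edges H = edges G" by (rule k_regular_cover_edges_eq[OF G H'(2,1) W(1,3) deg])
  moreover have "mc k G = k div 2"
  proof (rule mc_eqI[OF G c])
    fix c' assume "MC_coloring k G c'"
    then have "2 * card (c' ` edges G) \<le> k" by (rule k_regular_cover_colours[OF G _ W deg escape])
    then show "card (c' ` edges G) \<le> k div 2" by simp
  qed
  ultimately show ?thesis by (simp add: e_num_def)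
qed

lemma even_mc_coloring:
  assumes "simple_graph G" "2 \<le> card (verts G)" "k = 2 * m"
    and "\<And>a. a < m \<Longrightarrow> conn2 (verts G) {e \<in> edges G. c e = a}" "\<And>e. e \<in> edges G \<Longrightarrow> c e < m"
  shows "MC_coloring k G c" "card (c ` edges G) = k div 2"
  using MC_coloring_conn2_classes[OF assms(1,4)] card_colours_conn2_classes[OF assms(2,4,5)] assms(3)
  by simp_all

lemma mc_complete:
  assumes "even k" "2 \<le> k" and G: "complete_graph (k + 1) G"
    and H: "minimum_k_edge_connected_spanning_subgraph k H G"
  shows "mc k G + e_num H = e_num G + k div 2"
proof -
  obtain m where m: "k = 2 * m" using assms(1) by auto
  have fin: "finite (verts G)" and card: "card (verts G) = k + 1"
    and E: "edges G = {{u, v} | u v. u \<in> verts G \<and> v \<in> verts G \<and> u \<noteq> v}"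
    using G by (auto simp: complete_graph_def)
  have simple: "simple_graph G" by (rule simple_complete[OF G])
  obtain c where "\<And>a. a < m \<Longrightarrow> conn2 (verts G) {e \<in> edges G. c e = a}"
    "\<And>e. e \<in> edges G \<Longrightarrow> c e < m" using complete_graph_coloring[OF G m assms(2)] by blast
  then have c: "MC_coloring k G c" "card (c ` edges G) = k div 2"
    using even_mc_coloring[OF simple _ m] card assms(2) by simp_all
  obtain w0 where w0: "w0 \<in> verts G" using card by fastforce
  show ?thesis
  proof (rule regular_cover_mc[OF simple H order_refl w0 _ _ _ c])
    show "e \<inter> verts G \<noteq> {}" if "e \<in> edges G" for e using that E by auto
    show "card {e \<in> edges G. w \<in> e} \<le> k" if w: "w \<in> verts G" for w
    proof -
      have "{e \<in> edges G. w \<in> e} \<subseteq> (\<lambda>u. {w, u}) ` (verts G - {w})" using E by auto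
      then have "card {e \<in> edges G. w \<in> e} \<le> card (verts G - {w})"
        using fin surj_card_le[of "verts G - {w}"] by blast
      then show ?thesis using w fin card by simp
    qed
    fix w x assume w: "w \<in> verts G" "{w, x} \<in> edges G"
    have x: "x \<in> verts G" using w(2) simple by (auto simp: simple_graph_def)
    \<comment> \<open>With a target other than \<open>x\<close>, a path beginning \<open>w x\<close>
      must continue, so \<open>x\<close> is itself an inner vertex in \<open>W\<close>, which here
      consists of all vertices.\<close>
    have "\<not> verts G \<subseteq> {w, x}"
    proof
      assume "verts G \<subseteq> {w, x}"
      then have "card (verts G) \<le> card {w, x}" by (intro card_mono) auto
      also have "\<dots> \<le> 2" by (simp add: card_insert_if)
      finally show False using card assms(2) by simp
    qed
    then obtain v where v: "v \<in> verts G" "v \<noteq> w" "v \<noteq> x" by auto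
    have "\<exists>i>0. Suc i < length p \<and> p ! i \<in> verts G" if p: "is_path G w v p" "p ! 1 = x" for p
    proof -
      have "2 \<le> length p" "p ! (length p - 1) = v" using path_length[OF p(1)] v(2) by auto
      then have "length p \<noteq> 2" using p(2) v(3) by auto
      then show ?thesis using \<open>2 \<le> length p\<close> p(2) x by (intro exI[of _ 1]) auto
    qed
    then show "\<exists>v\<in>verts G. v \<noteq> w \<and> (\<forall>p. is_path G w v p \<and> p ! 1 = x \<longrightarrow>
        (\<exists>i>0. Suc i < length p \<and> p ! i \<in> verts G))" using v by blast
  qed
qed

text \<open>The covering set is the side \<open>B\<close>: its vertices have the \<open>k\<close>
  elements of \<open>A\<close> as neighbours, whereas those of \<open>A\<close> have degree
  \<open>n\<close>.\<close>

lemma mc_complete_bipartite: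
  assumes "complete_bipartite_graph k n G" "k \<le> n" "2 \<le> k" "even k \<or> k = 3"
    and Gk: "k_edge_connected k G" and H: "minimum_k_edge_connected_spanning_subgraph k H G"
  shows "mc k G + e_num H = e_num G + k div 2"
proof -
  obtain A B where fin: "finite A" "finite B" "A \<inter> B = {}" "card A = k" "card B = n"
    and V: "verts G = A \<union> B" and E: "edges G = {{a, b} | a b. a \<in> A \<and> b \<in> B}"
    using assms(1) by (auto simp: complete_bipartite_graph_def)
  have simple: "simple_graph G" and cV: "2 \<le> card (verts G)" using Gk by (auto simp: k_edge_connected_def)
  obtain w0 where w0: "w0 \<in> B" using fin(5) assms(2,3) by fastforce
  have nbr: "y \<in> B" if "{x, y} \<in> edges G" "x \<in> A" for x y
    using that fin(3) unfolding E by (auto simp: doubleton_eq_iff)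
  have cover: "e \<inter> B \<noteq> {}" if "e \<in> edges G" for e using that E by auto
  have deg: "card {e \<in> edges G. w \<in> e} \<le> k" if w: "w \<in> B" for w
  proof -
    have "{e \<in> edges G. w \<in> e} \<subseteq> (\<lambda>u. {u, w}) ` A" using w fin(3) unfolding E by auto
    then show ?thesis using fin(1,4) surj_card_le[of A] by blast
  qed
  have BV: "B \<subseteq> verts G" using V by simp
  have "\<exists>c. MC_coloring k G c \<and> card (c ` edges G) = k div 2"
  proof (cases "even k")
    case True
    then obtain m where m: "k = 2 * m" by auto
    obtain c where "\<And>a. a < m \<Longrightarrow> conn2 (verts G) {e \<in> edges G. c e = a}"
      "\<And>e. e \<in> edges G \<Longrightarrow> c e < m"
      using complete_bipartite_coloring[OF fin V E m assms(3,2)] by blast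
    then show ?thesis using even_mc_coloring[OF simple cV m] by blast
  next
    case False
    \<comment> \<open>Here \<open>k div 2\<close> is 1, so one colour on all edges is
      enough.\<close>
    then have k: "k = 3" using assms(4) by simp
    have "spanning_subgraph G G" using simple by (simp add: spanning_subgraph_def)
    then have "MC_coloring k G (\<lambda>_. 0)" by (rule MC_coloring_const_on_subgraph[OF Gk]) simp
    moreover obtain a where "a \<in> A" using fin(4) k by fastforce
    then have "{a, w0} \<in> edges G" using w0 E by blast
    then have "card ((\<lambda>_. 0 :: nat) ` edges G) = 1" by (simp add: image_constant)
    ultimately show ?thesis using k by auto
  qed
  then obtain c where c: "MC_coloring k G c" "card (c ` edges G) = k div 2" by blast
  show ?thesis
  proof (rule regular_cover_mc[OF simple H BV w0 cover deg _ c])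
    fix w x assume w: "w \<in> B" "{w, x} \<in> edges G"
    have x: "x \<in> A" using w fin(3) unfolding E by (auto simp: doubleton_eq_iff)
    \<comment> \<open>The target is a second vertex of \<open>A\<close>: a path beginning
      \<open>w x\<close> then returns to \<open>B\<close> at its third vertex and cannot end
      there.\<close>
    have "\<not> A \<subseteq> {x}" using card_mono[of "{x}" A] fin(4) assms(3) by auto
    then obtain v where v: "v \<in> A" "v \<noteq> x" by auto
    then have vw: "v \<noteq> w" "v \<in> verts G" using w fin(3) V by auto
    have "\<exists>i>0. Suc i < length p \<and> p ! i \<in> B" if p: "is_path G w v p" "p ! 1 = x" for p
    proof -
      have len: "2 \<le> length p" "p ! (length p - 1) = v" using path_length[OF p(1)] vw by auto
      then have "length p \<noteq> 2" using p(2) v(2) by auto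
      then have l3: "Suc 1 < length p" using len(1) by simp
      then have "{p ! 1, p ! Suc 1} \<in> edges G" using path_edges_nth[OF l3] p(1) by (auto simp: is_path_def)
      then have p2: "p ! 2 \<in> B" using nbr[of "p ! 1" "p ! 2"] p(2) x by (simp add: numeral_2_eq_2)
      then have "length p \<noteq> 3" using len(2) v(1) fin(3) by auto
      then show ?thesis using l3 p2 by (intro exI[of _ 2]) auto
    qed
    then show "\<exists>v\<in>verts G. v \<noteq> w \<and> (\<forall>p. is_path G w v p \<and> p ! 1 = x \<longrightarrow>
        (\<exists>i>0. Suc i < length p \<and> p ! i \<in> B))" using vw by blast
  qed
qed

theorem theorem2p1:
  fixes k :: nat and G H :: "'a ugraph"
  assumes "k \<ge> 2"
    and "k_edge_connected k G"
    and "minimum_k_edge_connected_spanning_subgraph k H G"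
    and "k = 2
       \<or> (k \<ge> 4 \<and> even k \<and> complete_graph (k + 1) G)
       \<or> ((\<exists>n\<ge>k. complete_bipartite_graph k n G) \<and> ((k \<ge> 4 \<and> even k) \<or> k = 3))"
  shows "int (mc k G) = int (e_num G) - int (e_num H) + \<lfloor>real k / 2\<rfloor>"
proof -
  have "mc k G + e_num H = e_num G + k div 2"
    using assms(4)
  proof (elim disjE conjE exE)
    assume "k = 2"
    then show ?thesis using mc_2[of G H] assms(2,3) by simp
  next
    assume "even k" "complete_graph (k + 1) G"
    then show ?thesis using mc_complete assms(1,3) by blast
  next
    fix n assume "k \<le> n" "complete_bipartite_graph k n G" "even k"
    then show ?thesis using mc_complete_bipartite assms(1-3) by blast
  next
    fix n assume "k \<le> n" "complete_bipartite_graph k n G" "k = 3"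
    then show ?thesis using mc_complete_bipartite assms(1-3) by blast
  qed
  moreover have "\<lfloor>real k / 2\<rfloor> = int (k div 2)" using floor_divide_of_nat_eq[of k 2] by simp
  ultimately show ?thesis by linarith
qed

end
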